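(* Let $d\ge 1$ and let $\Lambda\subseteq\mathbb{R}^d$ be a complete lattice. For $R>0$ put $N(\Lambda,R):=\#\{v\in\Lambda : |v|<R\}$. If $R>r_{\mathrm{bas}}(\Lambda)$, then \[ N(\Lambda,R)=\frac{\pi^{d/2}}{\Gamma(d/2+1)}\frac{R^d}{|\det\Lambda|}+O_d\!\left(\frac{1}{|\det\Lambda|}\, r_{\mathrm{bas}}(\Lambda)^{\frac{2d}{d+1}}\, R^{d\cdot\frac{d-1}{d+1}}\right), \] where the implied constant depends only on $d$.
   Context: A complete lattice in $\mathbb{R}^d$ is a free $\mathbb{Z}$-submodule of rank $d$ spanning $\mathbb{R}^d$; writing $\Lambda=\{Lx: x\in\mathbb{Z}^d\}$ with $L\in \mathrm{GL}_d(\mathbb{R})$, $\det\Lambda:=|\det L|$. $|v|$ is the Euclidean norm. $r_{\mathrm{bas}}(\Lambda)$ denotes the infimum of all $r>0$ such that the open ball of radius $r$ centered at $0$ contains a $\mathbb{Z}$-basis of $\Lambda$. *)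

theory Defs
  imports "HOL-Analysis.Analysis"
begin

global_interpretation int_module: module "\<lambda>(k::int) (v::'a::real_vector). of_int k *\<^sub>R v"
  by unfold_locales (simp_all add: algebra_simps)

definition Z_basis :: "'a::real_vector set \<Rightarrow> 'a set \<Rightarrow> bool" where
  "Z_basis B \<Lambda> \<longleftrightarrow> int_module.independent B \<and> int_module.span B = \<Lambda>"

definition full_lattice :: "(real ^ 'n) set \<Rightarrow> bool" where
  "full_lattice \<Lambda> \<longleftrightarrow>
     (\<exists>B. Z_basis B \<Lambda> \<and> finite B \<and> card B = CARD('n)) \<and> span \<Lambda> = UNIV"

definition lattice_of_matrix :: "real ^ 'n ^ 'n \<Rightarrow> (real ^ 'n) set" where
  "lattice_of_matrix L = {L *v x | x. \<forall>i. x $ i \<in> \<int>}"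

text \<open>
  The value does not depend on the choice of the matrix, see
  \<open>lattice_det_eq\<close> below; every full lattice arises from an invertible matrix by
  \<open>full_lattice_iff_matrix\<close>.
\<close>
definition lattice_det :: "(real ^ 'n) set \<Rightarrow> real" where
  "lattice_det \<Lambda> = (THE D. \<exists>L. invertible L \<and> \<Lambda> = lattice_of_matrix L \<and> D = \<bar>det L\<bar>)"

definition r_bas :: "(real ^ 'n) set \<Rightarrow> real" where
  "r_bas \<Lambda> = Inf {r. r > 0 \<and> (\<exists>B. Z_basis B \<Lambda> \<and> B \<subseteq> ball 0 r)}"

definition lattice_count :: "(real ^ 'n) set \<Rightarrow> real \<Rightarrow> nat" where
  "lattice_count \<Lambda> R = card {v \<in> \<Lambda>. norm v < R}"


lemma matrix_vector_mult_columns_scaleR: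
  "L *v x = (\<Sum>j\<in>UNIV. x $ j *\<^sub>R column j L)" for L :: "real ^ 'n ^ 'n"
  by (simp add: matrix_mult_sum scalar_mult_eq_scaleR)

lemma columns_in_lattice_of_matrix: "column j L \<in> lattice_of_matrix L"
proof -
  have "column j L = L *v axis j 1"
    by (simp add: matrix_vector_mult_basis)
  moreover have "\<forall>i. axis j (1 :: real) $ i \<in> \<int>"
    by (simp add: axis_def)
  ultimately show ?thesis
    unfolding lattice_of_matrix_def by blast
qed

lemma det_Ints:
  fixes A :: "real ^ 'n ^ 'n"
  assumes "\<And>i j. A $ i $ j \<in> \<int>"
  shows "det A \<in> \<int>"
  unfolding det_def using assms by (intro Ints_sum Ints_mult Ints_prod Ints_of_int) auto

lemma lattice_of_matrix_factor:
  fixes L M :: "real ^ 'n ^ 'n"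
  assumes "lattice_of_matrix M \<subseteq> lattice_of_matrix L"
  obtains A where "M = L ** A" "det A \<in> \<int>"
proof -
  have "\<forall>j. \<exists>x. column j M = L *v x \<and> (\<forall>i. x $ i \<in> \<int>)"
    using assms columns_in_lattice_of_matrix[of _ M] unfolding lattice_of_matrix_def by blast
  then obtain x where x: "\<And>j. column j M = L *v x j" "\<And>i j. x j $ i \<in> \<int>"
    by metis
  define A :: "real ^ 'n ^ 'n" where "A = (\<chi> i j. x j $ i)"
  have "M = L ** A"
    using x(1) by (simp add: vec_eq_iff A_def matrix_matrix_mult_def matrix_vector_mult_def column_def)
  moreover have "det A \<in> \<int>"
    using x(2) by (intro det_Ints) (simp add: A_def)
  ultimately show ?thesis ..
qed

lemma abs_det_eq_if_same_lattice:
  fixes L M :: "real ^ 'n ^ 'n"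
  assumes "invertible M" "lattice_of_matrix L = lattice_of_matrix M"
  shows "\<bar>det L\<bar> = \<bar>det M\<bar>"
proof -
  obtain A where A: "M = L ** A" "det A \<in> \<int>"
    using lattice_of_matrix_factor[of M L] assms by blast
  obtain B where B: "L = M ** B" "det B \<in> \<int>"
    using lattice_of_matrix_factor[of L M] assms by blast
  have "det M = det M * (det B * det A)"
    using arg_cong[OF A(1), of det] arg_cong[OF B(1), of det] by (simp add: det_mul)
  moreover have "det M \<noteq> 0"
    using assms(1) by (simp add: invertible_det_nz)
  ultimately have 1: "det B * det A = 1"
    by simp
  obtain a b where ab: "det A = of_int a" "det B = of_int b"
    using A(2) B(2) by (auto elim!: Ints_cases)
  have "b * a = 1"
    using 1 unfolding ab by (metis of_int_eq_1_iff of_int_mult)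
  then have "\<bar>b\<bar> = 1"
    by (metis abs_1 abs_mult abs_zmult_eq_1)
  then show ?thesis
    using B(1) ab by (simp add: det_mul abs_mult flip: of_int_abs)
qed

lemma lattice_det_eq:
  assumes "invertible L"
  shows "lattice_det (lattice_of_matrix L) = \<bar>det L\<bar>"
  unfolding lattice_det_def using assms by (intro the_equality) (auto dest: abs_det_eq_if_same_lattice)

lemma lattice_of_matrix_eq_int_span:
  fixes L :: "real ^ 'n ^ 'n"
  assumes "inj (\<lambda>j. column j L)"
  shows "lattice_of_matrix L = int_module.span (range (\<lambda>j. column j L))"
proof -
  have "int_module.span (range (\<lambda>j. column j L)) =
      range (\<lambda>u. \<Sum>j\<in>UNIV. of_int (u (column j L)) *\<^sub>R column j L)"
    by (simp add: int_module.span_finite sum.reindex[OF assms] o_def)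
  also have "\<dots> = range (\<lambda>c :: 'n \<Rightarrow> int. \<Sum>j\<in>UNIV. of_int (c j) *\<^sub>R column j L)"
  proof (safe, goal_cases)
    case (2 _ c)
    show ?case
      by (rule range_eqI[of _ _ "\<lambda>v. c (inv (\<lambda>j. column j L) v)"]) (simp add: inv_f_f[OF assms])
  qed auto
  also have "\<dots> = lattice_of_matrix L"
  proof (safe, goal_cases)
    case (1 _ c)
    show ?case
      by (auto simp: lattice_of_matrix_def matrix_vector_mult_columns_scaleR
               intro!: exI[of _ "\<chi> i. of_int (c i)"])
  next
    case (2 y)
    then obtain x where x: "y = L *v x" "\<And>i. x $ i \<in> \<int>"
      by (auto simp: lattice_of_matrix_def)
    then have "\<forall>i. \<exists>c. x $ i = of_int c"
      by (meson Ints_cases)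
    then obtain c where "\<And>i. x $ i = of_int (c i)"
      by metis
    then show ?case
      using x(1) by (auto simp: matrix_vector_mult_columns_scaleR)
  qed
  finally show ?thesis ..
qed

lemma full_lattice_iff_matrix:
  fixes \<Lambda> :: "(real ^ 'n) set"
  shows "full_lattice \<Lambda> \<longleftrightarrow> (\<exists>L. invertible L \<and> \<Lambda> = lattice_of_matrix L)"
proof
  assume "full_lattice \<Lambda>"
  then obtain B where B: "int_module.span B = \<Lambda>" "finite B" "card B = CARD('n)" "span \<Lambda> = UNIV"
    by (auto simp: full_lattice_def Z_basis_def)
  obtain f :: "'n \<Rightarrow> real ^ 'n" where f: "bij_betw f UNIV B"
    using B(2,3) finite_same_card_bij[of "UNIV :: 'n set" B] by auto
  define L :: "real ^ 'n ^ 'n" where "L = (\<chi> i j. f j $ i)"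
  have col: "column j L = f j" for j
    by (simp add: L_def column_def vec_eq_iff)
  have rng: "range (\<lambda>j. column j L) = B" and inj: "inj (\<lambda>j. column j L)"
    using f by (simp_all add: col[abs_def] bij_betw_def)
  have \<Lambda>: "\<Lambda> = lattice_of_matrix L"
    using lattice_of_matrix_eq_int_span[OF inj] rng B(1) by simp
  have "\<Lambda> \<subseteq> range ((*v) L)"
    unfolding \<Lambda> lattice_of_matrix_def by auto
  moreover have "subspace (range ((*v) L))"
    by (intro linear_subspace_image) auto
  ultimately have "span \<Lambda> \<subseteq> range ((*v) L)"
    by (rule span_minimal)
  then have "surj ((*v) L)"
    using B(4) by auto
  then have "invertible L"
    by (metis invertible_right_inverse matrix_right_invertible_surjective)
  with \<Lambda> show "\<exists>L. invertible L \<and> \<Lambda> = lattice_of_matrix L"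
    by blast
next
  assume "\<exists>L. invertible L \<and> \<Lambda> = lattice_of_matrix L"
  then obtain L :: "real ^ 'n ^ 'n" where L: "invertible L" "\<Lambda> = lattice_of_matrix L"
    by blast
  let ?B = "range (\<lambda>j. column j L)"
  obtain M where M: "M ** L = mat 1" "L ** M = mat 1"
    using L(1) unfolding invertible_def by blast
  have injL: "x = y" if "L *v x = L *v y" for x y
    using arg_cong[OF that, of "(*v) M"] by (simp add: matrix_vector_mul_assoc M)
  have inj: "inj (\<lambda>j. column j L)"
  proof (rule injI)
    fix i j assume "column i L = column j L"
    then have "L *v axis i 1 = L *v axis j 1"
      by (simp add: matrix_vector_mult_basis)
    then have "axis i (1 :: real) = axis j 1"
      by (rule injL)
    then show "i = j"
      by (simp add: axis_eq_axis)
  qed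
  have "int_module.independent ?B"
    unfolding int_module.dependent_finite[OF finite_imageI[OF finite]]
  proof (safe, goal_cases)
    case (1 u _ j)
    then have "L *v (\<chi> i. of_int (u (column i L))) = L *v 0"
      by (simp add: matrix_vector_mult_columns_scaleR sum.reindex[OF inj] o_def)
    then have "(\<chi> i. of_int (u (column i L))) = (0 :: real ^ 'n)"
      by (rule injL)
    then have "of_int (u (column j L)) = (0 :: real)"
      by (simp add: vec_eq_iff)
    with 1 show ?case by simp
  qed
  moreover have "int_module.span ?B = \<Lambda>"
    using lattice_of_matrix_eq_int_span[OF inj] L(2) by simp
  moreover have "card ?B = CARD('n)"
    using inj by (rule card_image)
  moreover have "span \<Lambda> = UNIV"
  proof -
    have "x \<in> span \<Lambda>" for x
    proof -
      have "x = L *v (M *v x)"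
        by (simp add: matrix_vector_mul_assoc M)
      also have "\<dots> \<in> span \<Lambda>"
        unfolding matrix_vector_mult_columns_scaleR[of L] L(2)
        by (intro span_sum span_scale span_base columns_in_lattice_of_matrix)
      finally show ?thesis .
    qed
    then show ?thesis
      by blast
  qed
  ultimately show "full_lattice \<Lambda>"
    unfolding full_lattice_def Z_basis_def by (intro conjI exI[of _ ?B]) auto
qed

end

theory Submission
  imports Defs "HOL-Complex_Analysis.Cauchy_Integral_Theorem"
begin

text \<open>
  In coordinates \<open>\<Lambda> = L \<int>\<^sup>d\<close> with columns of norm at most \<open>r\<close>, the shifted counts
  \<open>f(x) = #{m. |L (x + m)| < R}\<close> are averaged over the torus against a product of Fejer kernels of
  degree \<open>M\<close>, a finite trigonometric sum, so that no convergence question arises. The average is the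
  volume term plus the Fourier coefficients of the ellipsoid \<open>|L z| < R\<close> at integer frequencies
  \<open>0 < |n| < M\<close>; by the decay \<open>O(s powr (- (d + 1) / 2))\<close> of the Fourier transform of the ball these sum
  to \<open>R powr ((d - 1) / 2) * r powr ((d + 1) / 2) * M powr ((d - 1) / 2) / |det L|\<close>. As \<open>f\<close> is
  monotone in the radius, localising at scale \<open>1 / M\<close> costs \<open>R ^ (d - 1) * (r / M) / |det L|\<close>.
  The kernel has a constant amount of mass outside that scale, but there the error is at most its supremum,
  which can be absorbed into the left-hand side. Finally \<open>M\<close> is of the order of
  \<open>(R / r) powr ((d - 1) / (d + 1))\<close>.
\<close>

section \<open>Linear changes of variables and slices of the ball\<close>

text \<open>Apart from \<open>|det L|\<close>, the matrix enters only through the lengths of its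
  columns, which is why the constant depends on \<open>d\<close> alone. A frequency \<open>n\<close>
  has the dual vector \<open>w\<close> with \<open>n_i = w \<bullet> column i L\<close>, so
  \<open>|w| \<ge> |n_i| / r\<close>; a displacement \<open>u\<close> of the torus moves
  \<open>L *v u\<close> by at most the sum of the \<open>|u_i| * r\<close>. Only the shift 0 is
  wanted in the end, but the tail of the kernel beyond \<open>c\<close> is of order
  \<open>1 / (M * c)\<close>, which at the scale \<open>c = const / M\<close> does not tend to 0.
  The far part can be controlled only by the error at other shifts, so every estimate has to be
  uniform in \<open>x\<close>. The degree \<open>M\<close> balances the two errors:
  \<open>R powr (d - 1) * r / M\<close> and \<open>R powr ((d - 1) / 2) * r powr ((d + 1) / 2) * M
  powr ((d - 1) / 2)\<close> agree exactly when \<open>M = (R / r) powr ((d - 1) / (d + 1))\<close>.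
  The infimum \<open>r_bas\<close> supplies bases only for radii above it, so the bound is proved
  for all such radii and passed to the limit.\<close>

lemma Basis_real_vec: "Basis = range (\<lambda>i. axis i (1::real) :: real ^ 'n)"
  by (auto simp: Basis_vec_def)

lemma inj_axis_1: "inj (\<lambda>i. axis i (1::real) :: real ^ 'n)"
  by (auto simp: inj_on_def axis_eq_axis)

text \<open>Tonelli for \<open>lborel\<close> as a product over \<open>Basis\<close>. Both orders
  serve: with the coordinate along \<open>b0\<close> innermost a shear becomes a translation, with
  it outermost the ball is cut into slices.\<close>

lemma nn_integral_lborel_Basis_split:
  fixes h :: "'a::euclidean_space \<Rightarrow> ennreal"
  assumes [measurable]: "h \<in> borel_measurable borel" and b0: "b0 \<in> Basis"
  shows "(\<integral>\<^sup>+x. h x \<partial>lborel) =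
    (\<integral>\<^sup>+f. \<integral>\<^sup>+y. h (y *\<^sub>R b0 + (\<Sum>b\<in>Basis - {b0}. f b *\<^sub>R b)) \<partial>lborel
       \<partial>(\<Pi>\<^sub>M b\<in>Basis - {b0}. lborel))" (is "?A = ?B")
    and "(\<integral>\<^sup>+x. h x \<partial>lborel) =
    (\<integral>\<^sup>+y. \<integral>\<^sup>+f. h (y *\<^sub>R b0 + (\<Sum>b\<in>Basis - {b0}. f b *\<^sub>R b))
       \<partial>(\<Pi>\<^sub>M b\<in>Basis - {b0}. lborel) \<partial>lborel)" (is "_ = ?C")
proof -
  interpret product_sigma_finite "\<lambda>_::'a. lborel :: real measure"
    by standard
  have Basis: "Basis = insert b0 (Basis - {b0})"
    using b0 by auto
  have upd: "(\<Sum>b\<in>Basis. (f(b0 := y)) b *\<^sub>R b) = y *\<^sub>R b0 + (\<Sum>b\<in>Basis - {b0}. f b *\<^sub>R b)"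
    for f :: "'a \<Rightarrow> real" and y
    by (subst sum.remove[OF _ b0]) auto
  have [measurable]: "(\<lambda>f. h (\<Sum>b\<in>Basis. f b *\<^sub>R b)) \<in> borel_measurable (\<Pi>\<^sub>M b\<in>Basis. lborel)"
    by measurable
  have meas: "(\<lambda>f. h (\<Sum>b\<in>Basis. f b *\<^sub>R b))
      \<in> borel_measurable (\<Pi>\<^sub>M b\<in>insert b0 (Basis - {b0}). lborel)"
    unfolding Basis[symmetric] by measurable
  have "?A = (\<integral>\<^sup>+f. h (\<Sum>b\<in>Basis. f b *\<^sub>R b) \<partial>(\<Pi>\<^sub>M b\<in>insert b0 (Basis - {b0}). lborel))"
    unfolding Basis[symmetric] by (subst lborel_eq, subst nn_integral_distr) auto
  also have "\<dots> = ?B"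
    by (subst product_nn_integral_insert) (use meas in \<open>simp_all only: upd, simp_all\<close>)
  finally show "?A = ?B" .
  have "?A = (\<integral>\<^sup>+f. h (\<Sum>b\<in>Basis. f b *\<^sub>R b) \<partial>(\<Pi>\<^sub>M b\<in>insert b0 (Basis - {b0}). lborel))"
    unfolding Basis[symmetric] by (subst lborel_eq, subst nn_integral_distr) auto
  also have "\<dots> = ?C"
    by (subst product_nn_integral_insert_rev) (use meas in \<open>simp_all only: upd, simp_all\<close>)
  finally show "?A = ?C" .
qed

lemma nn_integral_lborel_translate:
  fixes h :: "'a::euclidean_space \<Rightarrow> ennreal"
  assumes [measurable]: "h \<in> borel_measurable borel"
  shows "(\<integral>\<^sup>+x. h (t + x) \<partial>lborel) = (\<integral>\<^sup>+x. h x \<partial>lborel)"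
proof -
  have "(\<integral>\<^sup>+x. h x \<partial>lborel) = (\<integral>\<^sup>+x. h x \<partial>distr lborel borel ((+) t))"
    by (simp add: lborel_distr_plus)
  also have "\<dots> = (\<integral>\<^sup>+x. h (t + x) \<partial>lborel)"
    by (subst nn_integral_distr) auto
  finally show ?thesis ..
qed

lemma nn_integral_lborel_linear:
  fixes f :: "real ^ 'n \<Rightarrow> real ^ 'n"
  assumes "linear f" "det (matrix f) \<noteq> 0" "h \<in> borel_measurable borel"
  shows "(\<integral>\<^sup>+x. h (f x) \<partial>lborel) * ennreal \<bar>det (matrix f)\<bar> = (\<integral>\<^sup>+x. h x \<partial>lborel)"
proof -
  \<comment> \<open>The determinant condition sits inside the predicate: a nonsingular composition
    has nonsingular factors, and the maps with a vanishing coordinate satisfy \<open>P\<close>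
    vacuously.\<close>
  define P where "P f \<longleftrightarrow> (det (matrix f) \<noteq> 0 \<longrightarrow> (\<forall>h\<in>borel_measurable borel.
    (\<integral>\<^sup>+x. h (f x) \<partial>lborel) * ennreal \<bar>det (matrix f)\<bar> = (\<integral>\<^sup>+x. h x \<partial>lborel)))"
    for f :: "real ^ 'n \<Rightarrow> real ^ 'n"
  have "P f"
  proof (induction f rule: induct_linear_elementary)
    case 1
    show ?case by (rule assms(1))
  next
    case (2 f g)
    have [measurable]: "f \<in> borel_measurable borel"
      using 2 by (simp add: borel_measurable_continuous_onI linear_continuous_on linear_linear)
    show ?case
      unfolding P_def
    proof safe
      fix h :: "real ^ 'n \<Rightarrow> ennreal"
      assume [measurable]: "h \<in> borel_measurable borel" and nz: "det (matrix (f \<circ> g)) \<noteq> 0"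
      have det: "det (matrix (f \<circ> g)) = det (matrix f) * det (matrix g)"
        using 2 by (simp add: matrix_compose det_mul)
      with nz have *: "det (matrix f) \<noteq> 0" "det (matrix g) \<noteq> 0"
        by auto
      have "(\<integral>\<^sup>+x. h ((f \<circ> g) x) \<partial>lborel) * ennreal \<bar>det (matrix (f \<circ> g))\<bar> =
          ((\<integral>\<^sup>+x. (h \<circ> f) (g x) \<partial>lborel) * ennreal \<bar>det (matrix g)\<bar>) * ennreal \<bar>det (matrix f)\<bar>"
        by (simp add: det abs_mult ennreal_mult' mult_ac)
      also have "\<dots> = (\<integral>\<^sup>+x. (h \<circ> f) x \<partial>lborel) * ennreal \<bar>det (matrix f)\<bar>"
      proof -
        have "h \<circ> f \<in> borel_measurable borel"
          by measurable
        with 2(4) * show ?thesis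
          unfolding P_def by metis
      qed
      also have "\<dots> = (\<integral>\<^sup>+x. h x \<partial>lborel)"
        using 2(3) * unfolding P_def by (simp add: o_def)
      finally show "(\<integral>\<^sup>+x. h ((f \<circ> g) x) \<partial>lborel) * ennreal \<bar>det (matrix (f \<circ> g))\<bar> =
          (\<integral>\<^sup>+x. h x \<partial>lborel)" .
    qed
  next
    case (3 f i)
    have "\<not> surj f"
    proof
      assume "surj f"
      then obtain x where "f x = axis i 1"
        by (metis surj_def)
      with 3(2)[of x] show False
        by simp
    qed
    then have "det (matrix f) = 0"
      using 3(1) det_nz_iff_inj linear_injective_imp_surjective by blast
    then show ?case
      by (simp add: P_def)
  next
    case (4 c)
    have det: "det (matrix (\<lambda>x. \<chi> i. c i * x $ i)) = (\<Prod>i\<in>UNIV. c i)"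
      by (subst det_diagonal) (auto simp: matrix_def axis_def)
    show ?case
      unfolding P_def det
    proof safe
      fix h :: "real ^ 'n \<Rightarrow> ennreal"
      assume [measurable]: "h \<in> borel_measurable borel" and nz: "prod c UNIV \<noteq> 0"
      \<comment> \<open>\<open>lborel_affine_euclidean\<close> wants its factors indexed by basis
        vectors, so \<open>c'\<close> reads off the unique \<open>i\<close> with
        \<open>b = axis i 1\<close>.\<close>
      define c' where "c' b = c (SOME i. b = axis i 1)" for b :: "real ^ 'n"
      have c': "c' (axis i 1) = c i" for i
        unfolding c'_def by (rule arg_cong[of _ _ c]) (auto simp: axis_eq_axis)
      let ?T = "\<lambda>x. 0 + (\<Sum>j\<in>Basis. (c' j * (x \<bullet> j)) *\<^sub>R j) :: real ^ 'n"
      have T: "?T x = (\<chi> i. c i * x $ i)" for x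
        unfolding Basis_real_vec sum.reindex[OF inj_axis_1]
        by (simp add: c' inner_axis) (simp add: vec_eq_iff axis_def if_distrib cong: if_cong)
      have pr: "(\<Prod>j\<in>Basis. \<bar>c' j\<bar>) = \<bar>prod c UNIV\<bar>"
        unfolding Basis_real_vec prod.reindex[OF inj_axis_1] by (simp add: c' abs_prod)
      have "c' j \<noteq> 0" if "j \<in> Basis" for j
        using that nz by (auto simp: Basis_real_vec c')
      note aff = lborel_affine_euclidean[of c' 0, OF this, unfolded T pr]
      have [measurable]: "(\<lambda>x. \<chi> i. c i * x $ i) \<in> borel_measurable borel"
        unfolding T[symmetric] by measurable
      have "(\<integral>\<^sup>+x. h x \<partial>lborel) = (\<integral>\<^sup>+x. h x \<partial>density (distr lborel borel (\<lambda>x. \<chi> i. c i * x $ i))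
          (\<lambda>_. \<bar>prod c UNIV\<bar>))"
        using aff by simp
      also have "\<dots> = (\<integral>\<^sup>+x. h (\<chi> i. c i * x $ i) \<partial>lborel) * ennreal \<bar>prod c UNIV\<bar>"
        by (simp add: nn_integral_density nn_integral_distr nn_integral_cmult mult.commute)
      finally show "(\<integral>\<^sup>+x. h (\<chi> i. c i * x $ i) \<partial>lborel) * ennreal \<bar>prod c UNIV\<bar> =
          (\<integral>\<^sup>+x. h x \<partial>lborel)" ..
    qed
  next
    case (5 m n)
    let ?f = "\<lambda>x::real ^ 'n. (\<chi> i. x $ Transposition.transpose m n i) :: real ^ 'n"
    have [measurable]: "?f \<in> borel_measurable borel"
      by (intro borel_measurable_continuous_onI continuous_intros)
    have "matrix ?f = transpose (\<chi> i j. mat 1 $ i $ Transposition.transpose m n j)"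
      by (auto simp: matrix_def transpose_def mat_def axis_def vec_eq_iff transpose_eq_iff)
    then have "\<bar>det (matrix ?f)\<bar> = \<bar>det (\<chi> i j. mat 1 $ i $ Transposition.transpose m n j :: real^'n^'n)\<bar>"
      by simp
    also have "\<dots> = 1"
      using det_permute_columns[of "Transposition.transpose m n" "mat 1 :: real^'n^'n"]
      by (simp add: permutes_swap_id abs_mult sign_def)
    finally have det: "\<bar>det (matrix ?f)\<bar> = 1" .
    \<comment> \<open>\<open>lborel\<close> is determined by its values on boxes, and a
      transposition only permutes the side lengths of a box.\<close>
    have eq: "lborel = distr lborel borel ?f"
    proof (rule lborel_eqI)
      fix l u :: "real ^ 'n" assume le: "\<And>b. b \<in> Basis \<Longrightarrow> l \<bullet> b \<le> u \<bullet> b"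
      have pre: "?f -` box l u = box (?f l) (?f u)"
        by (simp add: set_eq_iff mem_box_cart) (metis transpose_involutory)
      have le': "?f l \<bullet> b \<le> ?f u \<bullet> b" if "b \<in> Basis" for b
      proof -
        have "l $ i \<le> u $ i" for i
          using le[of "axis i 1"] axis_in_Basis_iff[of i "1::real"] by (simp add: inner_axis)
        then show ?thesis
          using that by (auto simp: Basis_real_vec inner_axis)
      qed
      have "emeasure (distr lborel borel ?f) (box l u) = ennreal (\<Prod>b\<in>Basis. (?f u - ?f l) \<bullet> b)"
        using le' by (simp add: emeasure_distr pre emeasure_lborel_box_eq)
      also have "(\<Prod>b\<in>Basis. (?f u - ?f l) \<bullet> b) = (\<Prod>b\<in>Basis. (u - l) \<bullet> b)"
        unfolding Basis_real_vec prod.reindex[OF inj_axis_1]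
        using prod.permute[OF permutes_swap_id, of m UNIV n "\<lambda>i. (u - l) $ i"]
        by (simp add: inner_axis o_def)
      finally show "emeasure (distr lborel borel ?f) (box l u) = ennreal (\<Prod>b\<in>Basis. (u - l) \<bullet> b)" .
    qed simp
    have "(\<integral>\<^sup>+x. h (?f x) \<partial>lborel) = (\<integral>\<^sup>+x. h x \<partial>lborel)" if [measurable]: "h \<in> borel_measurable borel"
      for h :: "real ^ 'n \<Rightarrow> ennreal"
      using arg_cong[OF eq, of "\<lambda>M. \<integral>\<^sup>+x. h x \<partial>M"] by (simp add: nn_integral_distr)
    then show ?case
      unfolding P_def det by simp
  next
    case (6 m n)
    let ?f = "\<lambda>x::real ^ 'n. (\<chi> i. if i = m then x $ m + x $ n else x $ i) :: real ^ 'n"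
    have "matrix ?f = (\<chi> k. if k = m then row m (mat 1) + 1 *s row n (mat 1) else row k (mat 1))"
      by (auto simp: matrix_def vec_eq_iff row_def mat_def axis_def)
    then have det: "det (matrix ?f) = 1"
      by (simp only: det_row_operation[OF 6] det_I)
    have "linear ?f"
      by (rule linearI) (auto simp: vec_eq_iff algebra_simps)
    then have [measurable]: "?f \<in> borel_measurable borel"
      by (simp add: borel_measurable_continuous_onI linear_continuous_on linear_linear)
    \<comment> \<open>On each line parallel to \<open>axis m 1\<close> the shear is a translation by
      the constant \<open>s $ n\<close>, since \<open>n \<noteq> m\<close>.\<close>
    have split: "?f (y *\<^sub>R axis m 1 + s) = (s $ n + y) *\<^sub>R axis m 1 + s" if "s $ m = 0" for y s
      using 6 that by (auto simp: vec_eq_iff axis_def)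
    have s: "(\<Sum>b\<in>Basis - {axis m 1}. g b *\<^sub>R b) $ m = 0" for g :: "real ^ 'n \<Rightarrow> real"
    proof -
      have "axis j (1::real) $ m = 0" if "j \<noteq> m" for j
        using that by (simp add: axis_def)
      then show ?thesis
        by (force simp: sum_component Basis_real_vec intro!: sum.neutral)
    qed
    have "(\<integral>\<^sup>+x. h (?f x) \<partial>lborel) = (\<integral>\<^sup>+x. h x \<partial>lborel)" if [measurable]: "h \<in> borel_measurable borel"
      for h :: "real ^ 'n \<Rightarrow> ennreal"
    proof -
      have "(\<integral>\<^sup>+x. h (?f x) \<partial>lborel) = (\<integral>\<^sup>+g. \<integral>\<^sup>+y. h (?f (y *\<^sub>R axis m 1 + (\<Sum>b\<in>Basis - {axis m 1}. g b *\<^sub>R b)))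
          \<partial>lborel \<partial>(\<Pi>\<^sub>M b\<in>Basis - {axis m 1}. lborel))"
        by (rule nn_integral_lborel_Basis_split) (auto simp: Basis_real_vec)
      also have "\<dots> = (\<integral>\<^sup>+g. \<integral>\<^sup>+y. h (y *\<^sub>R axis m 1 + (\<Sum>b\<in>Basis - {axis m 1}. g b *\<^sub>R b))
          \<partial>lborel \<partial>(\<Pi>\<^sub>M b\<in>Basis - {axis m 1}. lborel))"
        unfolding split[OF s] by (intro nn_integral_cong nn_integral_lborel_translate[of "\<lambda>y. h (y *\<^sub>R _ + _)"]) measurable
      also have "\<dots> = (\<integral>\<^sup>+x. h x \<partial>lborel)"
        by (rule nn_integral_lborel_Basis_split[symmetric]) (auto simp: Basis_real_vec)
      finally show ?thesis .
    qed
    then show ?case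
      unfolding P_def det by simp
  qed
  then show ?thesis
    using assms by (simp add: P_def)
qed

lemma distr_lborel_linear:
  fixes f :: "real ^ 'n \<Rightarrow> real ^ 'n"
  assumes "linear f" "det (matrix f) \<noteq> 0"
  shows "distr lborel borel f = density lborel (\<lambda>_. ennreal (1 / \<bar>det (matrix f)\<bar>))"
proof (rule measure_eqI)
  fix A assume "A \<in> sets (distr lborel borel f)"
  then have A[measurable]: "A \<in> sets borel"
    by simp
  have [measurable]: "f \<in> borel_measurable borel"
    using assms(1) by (simp add: borel_measurable_continuous_onI linear_continuous_on linear_linear)
  have "emeasure (distr lborel borel f) A = (\<integral>\<^sup>+x. indicator A x \<partial>distr lborel borel f)"
    by simp
  also have "\<dots> = (\<integral>\<^sup>+x. indicator A (f x) \<partial>lborel)"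
    by (subst nn_integral_distr) auto
  also have "\<dots> = (\<integral>\<^sup>+x. indicator A (f x) \<partial>lborel) * ennreal \<bar>det (matrix f)\<bar> * ennreal (1 / \<bar>det (matrix f)\<bar>)"
    using assms(2) by (simp add: mult.assoc flip: ennreal_mult')
  also have "(\<integral>\<^sup>+x. indicator A (f x) \<partial>lborel) * ennreal \<bar>det (matrix f)\<bar> = (\<integral>\<^sup>+x. indicator A x \<partial>lborel)"
    by (rule nn_integral_lborel_linear[OF assms]) auto
  finally show "emeasure (distr lborel borel f) A =
      emeasure (density lborel (\<lambda>_. ennreal (1 / \<bar>det (matrix f)\<bar>))) A"
    by (simp add: emeasure_density_const mult.commute)
qed auto

lemma integral_lborel_linear:
  fixes f :: "real ^ 'n \<Rightarrow> real ^ 'n" and h :: "real ^ 'n \<Rightarrow> 'b::{banach, second_countable_topology}"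
  assumes "linear f" "det (matrix f) \<noteq> 0" and [measurable]: "h \<in> borel_measurable borel"
  shows "(\<integral>x. h (f x) \<partial>lborel) = (1 / \<bar>det (matrix f)\<bar>) *\<^sub>R (\<integral>x. h x \<partial>lborel)"
proof -
  have [measurable]: "f \<in> borel_measurable borel"
    using assms(1) by (simp add: borel_measurable_continuous_onI linear_continuous_on linear_linear)
  have "(\<integral>x. h (f x) \<partial>lborel) = (\<integral>x. h x \<partial>distr lborel borel f)"
    by (simp add: integral_distr)
  also have "\<dots> = (\<integral>x. (1 / \<bar>det (matrix f)\<bar>) *\<^sub>R h x \<partial>lborel)"
    unfolding distr_lborel_linear[OF assms(1,2)] by (simp add: integral_density)
  finally show ?thesis
    by simp
qed

section \<open>Slices of the unit ball orthogonal to a coordinate axis\<close>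

lemma distr_cball_inner_Basis:
  fixes b0 :: "'a::euclidean_space"
  assumes b0: "b0 \<in> Basis"
  shows "distr (density lborel (indicator (cball 0 1))) borel (\<lambda>y. y \<bullet> b0) =
    density lborel (\<lambda>t. ennreal (indicator {-1..1} t *
      (unit_ball_vol (DIM('a) - 1) * sqrt (1 - t\<^sup>2) ^ (DIM('a) - 1))))"
proof (rule measure_eqI)
  fix A assume "A \<in> sets (distr (density lborel (indicator (cball 0 1))) borel (\<lambda>y::'a. y \<bullet> b0))"
  then have A[measurable]: "A \<in> sets borel"
    by simp
  let ?B = "Basis - {b0}" and ?P = "\<Pi>\<^sub>M b\<in>Basis - {b0}. (lborel :: real measure)"
  let ?S = "\<lambda>r. {f::'a\<Rightarrow>real. sqrt (\<Sum>b\<in>?B. (f b)\<^sup>2) \<le> r} \<inter> space ?P"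
  have card: "card ?B = DIM('a) - 1"
    using b0 by simp
  have nrm: "norm (t *\<^sub>R b0 + (\<Sum>b\<in>?B. f b *\<^sub>R b)) ^ 2 = t\<^sup>2 + (\<Sum>b\<in>?B. (f b)\<^sup>2)" for t and f :: "'a \<Rightarrow> real"
  proof -
    have "t *\<^sub>R b0 + (\<Sum>b\<in>?B. f b *\<^sub>R b) = (\<Sum>b\<in>Basis. (if b = b0 then t else f b) *\<^sub>R b)"
      by (subst sum.remove[OF _ b0]) auto
    also have "norm \<dots> ^ 2 = (\<Sum>b\<in>Basis. (if b = b0 then t else f b)\<^sup>2)"
      unfolding power2_norm_eq_inner by (subst euclidean_inner) (simp add: power2_eq_square)
    also have "\<dots> = t\<^sup>2 + (\<Sum>b\<in>?B. (f b)\<^sup>2)"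
      by (subst sum.remove[OF _ b0]) auto
    finally show ?thesis .
  qed
  have [measurable]: "cball (0::'a) 1 \<in> sets borel"
    by simp
  have inn: "(t *\<^sub>R b0 + (\<Sum>b\<in>?B. f b *\<^sub>R b)) \<bullet> b0 = t" for t and f :: "'a \<Rightarrow> real"
    using b0 by (auto simp: inner_add_left inner_sum_left inner_Basis intro!: sum.neutral)
  have "emeasure (distr (density lborel (indicator (cball 0 1))) borel (\<lambda>y. y \<bullet> b0)) A =
      (\<integral>\<^sup>+y. indicator (cball 0 1) y * indicator A (y \<bullet> b0) \<partial>lborel)"
  proof -
    have [measurable]: "(\<lambda>y::'a. y \<bullet> b0) -` A \<in> sets borel" "cball (0::'a) 1 \<in> sets borel"
      using measurable_sets_borel[OF borel_measurable_inner[OF measurable_ident borel_measurable_const] A, of b0] by auto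
    have "emeasure (distr (density lborel (indicator (cball 0 1))) borel (\<lambda>y. y \<bullet> b0)) A =
        emeasure (density lborel (indicator (cball 0 1))) ((\<lambda>y. y \<bullet> b0) -` A)"
      by (simp add: emeasure_distr)
    also have "\<dots> = (\<integral>\<^sup>+y. indicator (cball 0 1) y * indicator ((\<lambda>y. y \<bullet> b0) -` A) y \<partial>lborel)"
      by (rule emeasure_density) auto
    finally show ?thesis
      by (simp add: indicator_def)
  qed
  also have "\<dots> = (\<integral>\<^sup>+t. \<integral>\<^sup>+f. indicator (cball 0 1) (t *\<^sub>R b0 + (\<Sum>b\<in>?B. f b *\<^sub>R b)) *
      indicator A ((t *\<^sub>R b0 + (\<Sum>b\<in>?B. f b *\<^sub>R b)) \<bullet> b0) \<partial>?P \<partial>lborel)"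
    by (intro nn_integral_lborel_Basis_split(2)[where h = "\<lambda>y. indicator (cball 0 1) y * indicator A (y \<bullet> b0)"] b0)
       measurable
  also have "\<dots> = (\<integral>\<^sup>+t. ennreal (indicator {-1..1} t *
      (unit_ball_vol (DIM('a) - 1) * sqrt (1 - t\<^sup>2) ^ (DIM('a) - 1))) * indicator A t \<partial>lborel)"
  proof (rule nn_integral_cong_AE)
    \<comment> \<open>At the two endpoints the slice has radius 0, whereas
      \<open>emeasure_cball_aux\<close> is applied with a positive radius.\<close>
    have "AE t::real in lborel. t \<notin> {-1, 1}"
      by (intro AE_not_in countable_imp_null_set_lborel) auto
    then show "AE t in lborel. (\<integral>\<^sup>+f. indicator (cball 0 1) (t *\<^sub>R b0 + (\<Sum>b\<in>?B. f b *\<^sub>R b)) *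
      indicator A ((t *\<^sub>R b0 + (\<Sum>b\<in>?B. f b *\<^sub>R b)) \<bullet> b0) \<partial>?P) = ennreal (indicator {-1..1} t *
      (unit_ball_vol (DIM('a) - 1) * sqrt (1 - t\<^sup>2) ^ (DIM('a) - 1))) * indicator A t"
    proof eventually_elim
      case (elim t)
      have ind: "indicator (cball 0 1) (t *\<^sub>R b0 + (\<Sum>b\<in>?B. f b *\<^sub>R b)) =
          (if \<bar>t\<bar> < 1 then indicator (?S (sqrt (1 - t\<^sup>2))) f else 0 :: ennreal)" if "f \<in> space ?P" for f
      proof -
        have "norm (t *\<^sub>R b0 + (\<Sum>b\<in>?B. f b *\<^sub>R b)) \<le> 1 \<longleftrightarrow> t\<^sup>2 + (\<Sum>b\<in>?B. (f b)\<^sup>2) \<le> 1"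
          unfolding nrm[symmetric] by (simp add: power_le_one_iff)
        moreover have "\<bar>t\<bar> < 1" if "t\<^sup>2 + (\<Sum>b\<in>?B. (f b)\<^sup>2) \<le> 1"
        proof -
          have "0 \<le> (\<Sum>b\<in>?B. (f b)\<^sup>2)"
            by (intro sum_nonneg) auto
          with that have "t\<^sup>2 \<le> 1" by linarith
          then show ?thesis
            using elim by (auto simp: abs_square_le_1 abs_less_iff order_less_le)
        qed
        ultimately show ?thesis
          using that by (auto simp: indicator_def)
      qed
      show ?case
      proof (cases "\<bar>t\<bar> < 1")
        case True
        then have pos: "0 < sqrt (1 - t\<^sup>2)"
          by (simp add: abs_square_less_1)
        have "(\<integral>\<^sup>+f. indicator (cball 0 1) (t *\<^sub>R b0 + (\<Sum>b\<in>?B. f b *\<^sub>R b)) *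
            indicator A ((t *\<^sub>R b0 + (\<Sum>b\<in>?B. f b *\<^sub>R b)) \<bullet> b0) \<partial>?P) =
            (\<integral>\<^sup>+f. indicator (?S (sqrt (1 - t\<^sup>2))) f * indicator A t \<partial>?P)"
          using True by (intro nn_integral_cong) (simp add: ind inn)
        also have "\<dots> = emeasure ?P (?S (sqrt (1 - t\<^sup>2))) * indicator A t"
          by (subst nn_integral_multc) (auto simp del: real_sqrt_le_iff)
        also have "emeasure ?P (?S (sqrt (1 - t\<^sup>2))) =
            ennreal (unit_ball_vol (DIM('a) - 1) * sqrt (1 - t\<^sup>2) ^ (DIM('a) - 1))"
          using emeasure_cball_aux[OF _ pos, of ?B] card by simp
        finally show ?thesis
          using True by (simp add: indicator_def abs_less_iff)
      next
        case False
        then have "t \<notin> {-1..1}"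
          using elim by auto
        moreover have "(\<integral>\<^sup>+f. indicator (cball 0 1) (t *\<^sub>R b0 + (\<Sum>b\<in>?B. f b *\<^sub>R b)) *
            indicator A ((t *\<^sub>R b0 + (\<Sum>b\<in>?B. f b *\<^sub>R b)) \<bullet> b0) \<partial>?P) = (\<integral>\<^sup>+f. 0 \<partial>?P)"
          using False by (intro nn_integral_cong) (simp add: ind)
        ultimately show ?thesis
          by simp
      qed
    qed
  qed
  finally show "emeasure (distr (density lborel (indicator (cball 0 1))) borel (\<lambda>y. y \<bullet> b0)) A =
      emeasure (density lborel (\<lambda>t. ennreal (indicator {-1..1} t *
      (unit_ball_vol (DIM('a) - 1) * sqrt (1 - t\<^sup>2) ^ (DIM('a) - 1))))) A"
    by (simp add: emeasure_density)
qed auto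

text \<open>Integration against the image of the uniform measure under
  \<open>y \<bullet> b0\<close>; as an identity of measures it gives the formula for every
  measurable \<open>g\<close>. Passing between the open and the closed ball is harmless because the
  sphere is a null set.\<close>

lemma integral_ball_inner_Basis:
  fixes b0 :: "'a::euclidean_space" and g :: "real \<Rightarrow> complex"
  assumes b0: "b0 \<in> Basis" and [measurable]: "g \<in> borel_measurable borel"
  shows "(\<integral>y. indicator (ball 0 1) y *\<^sub>R g (y \<bullet> b0) \<partial>lborel) =
    unit_ball_vol (DIM('a) - 1) *\<^sub>R
      (\<integral>t. indicator {-1..1} t *\<^sub>R (sqrt (1 - t\<^sup>2) ^ (DIM('a) - 1) *\<^sub>R g t) \<partial>lborel)"
proof -
  have [measurable]: "cball (0::'a) 1 \<in> sets borel"
    by simp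
  have "AE y::'a in lborel. y \<notin> sphere 0 1"
    using negligible_sphere[of "0::'a" 1]
    by (intro AE_not_in) (auto simp: null_sets_completion_iff negligible_iff_null_sets)
  then have "(\<integral>y. indicator (ball 0 1) y *\<^sub>R g (y \<bullet> b0) \<partial>lborel) =
      (\<integral>y. indicator (cball 0 1) y *\<^sub>R g (y \<bullet> b0) \<partial>lborel)"
    by (intro integral_cong_AE) (auto simp: indicator_def)
  also have "\<dots> = (\<integral>y. g (y \<bullet> b0) \<partial>density lborel (indicator (cball 0 1)))"
    by (subst integral_density[of _ _ "indicator (cball 0 1)", symmetric]) (auto simp: ennreal_indicator)
  also have "\<dots> = (\<integral>t. g t \<partial>distr (density lborel (indicator (cball 0 1))) borel (\<lambda>y. y \<bullet> b0))"
    by (subst integral_distr) auto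
  also have "\<dots> = (\<integral>t. (indicator {-1..1} t * (unit_ball_vol (DIM('a) - 1) * sqrt (1 - t\<^sup>2) ^ (DIM('a) - 1))) *\<^sub>R g t \<partial>lborel)"
    unfolding distr_cball_inner_Basis[OF b0]
    by (subst integral_density) (auto intro!: AE_I2 simp: indicator_def abs_square_le_1 abs_le_iff)
  also have "\<dots> = (\<integral>t. unit_ball_vol (DIM('a) - 1) *\<^sub>R (indicator {-1..1} t *\<^sub>R (sqrt (1 - t\<^sup>2) ^ (DIM('a) - 1) *\<^sub>R g t)) \<partial>lborel)"
    by (simp add: mult_ac)
  finally show ?thesis
    by (simp only: integral_scaleR_right)
qed

section \<open>An oscillatory integral\<close>

text \<open>The substitution \<open>lam * y\<close> turns the left side into a power of
  \<open>lam\<close> times a Gamma integral truncated at \<open>lam\<close>.\<close>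

lemma integral_exp_sqrt_power_le:
  fixes lam :: real and k :: nat
  assumes "lam > 0"
  shows "integral {0..1} (\<lambda>y. exp (- (lam * y)) * sqrt y ^ k)
    \<le> Gamma (real k / 2 + 1) / lam powr (real k / 2 + 1)"
proof -
  define g where "g y = exp (- y) * sqrt y ^ k" for y :: real
  have "((\<lambda>t. t powr (real k / 2 + 1 - 1) / exp t) has_integral Gamma (real k / 2 + 1)) {0..}"
    by (rule Gamma_integral_real) simp
  \<comment> \<open>The point 0 is discarded because for \<open>k = 0\<close> the integrands differ
    there: \<open>0 powr 0 = 0\<close> but \<open>sqrt 0 ^ 0 = 1\<close>.\<close>
  then have G: "(g has_integral Gamma (real k / 2 + 1)) {0..}"
  proof (rule has_integral_spike[of "{0}", rotated 2])
    fix x :: real assume "x \<in> {0..} - {0}"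
    then show "g x = x powr (real k / 2 + 1 - 1) / exp x"
      by (simp add: g_def exp_minus field_simps powr_half_sqrt[symmetric] powr_power)
  qed auto
  have I: "g integrable_on {0..lam}"
    unfolding g_def by (intro integrable_continuous_interval continuous_intros)
  have le: "integral {0..lam} g \<le> Gamma (real k / 2 + 1)"
    using integral_subset_le[of "{0..lam}" "{0..}" g] I G
    by (auto simp: has_integral_iff g_def)
  have "(g has_integral integral {0..lam} g) (cbox 0 lam)"
    using I by (simp add: integrable_integral)
  note * = has_integral_affinity[OF this, of lam 0]
  have "((\<lambda>y. g (lam * y)) has_integral integral {0..lam} g / lam) {0..1}"
  proof -
    have "(\<lambda>x. x * inverse lam) ` {0..lam} = {0..1}"
      using image_divide_atLeastAtMost[of lam 0 lam] assms by (simp add: divide_inverse)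
    then show ?thesis
      using * assms by (simp add: divide_inverse mult.commute)
  qed
  from has_integral_mult_right[OF this, of "lam powr (- (real k / 2))"]
  have hi: "((\<lambda>y. exp (- (lam * y)) * sqrt y ^ k) has_integral
      lam powr (- (real k / 2)) * (integral {0..lam} g / lam)) {0..1}"
  proof (rule has_integral_eq[rotated])
    have "lam powr (- (real k / 2)) * sqrt lam ^ k = 1"
      using assms by (simp add: powr_minus powr_half_sqrt[symmetric] powr_power)
    then show "lam powr (- (real k / 2)) * g (lam * x) = exp (- (lam * x)) * sqrt x ^ k" for x
      by (simp add: g_def real_sqrt_mult power_mult_distrib mult.assoc[symmetric])
  qed
  have "lam powr (- (real k / 2)) * (integral {0..lam} g / lam) \<le>
      lam powr (- (real k / 2)) * (Gamma (real k / 2 + 1) / lam)"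
    using le assms by (intro mult_left_mono divide_right_mono) auto
  also have "\<dots> = Gamma (real k / 2 + 1) / lam powr (real k / 2 + 1)"
    using assms powr_add[of lam "real k / 2" 1] by (simp add: powr_minus field_simps del: add_divide_distrib)
  finally show ?thesis
    using hi by (simp add: integral_unique)
qed

text \<open>Shifting the contour to the other three sides of the rectangle with corners
  \<open>\<plusminus>1\<close>, \<open>\<plusminus>1 + \<i>\<close>: on the vertical sides the integrand is at most
  \<open>exp (- lam y) (3 y) powr (k / 2)\<close>.\<close>
lemma oscillatory_integral_bound:
  fixes k :: nat
  shows "\<exists>C\<ge>0. \<forall>lam>0. cmod (integral {-1..1} (\<lambda>t. (sqrt (1 - t\<^sup>2) ^ k) *\<^sub>R cis (lam * t)))
    \<le> C * lam powr (- (real k / 2 + 1))"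
proof -
  define f where "f lam z = csqrt (1 - z\<^sup>2) ^ k * exp (\<i> * of_real lam * z)" for lam z
  define S where "S = cbox (-1) (1 + \<i>)"
  \<comment> \<open>The real part is \<open>1 - x^2 + y^2\<close> with \<open>|x| \<le> 1\<close>,
    so on the rectangle the principal root is never evaluated across its branch cut.\<close>
  have Re_nonneg: "0 \<le> Re (1 - z\<^sup>2)" if "z \<in> S" for z
  proof -
    have "(Re z)\<^sup>2 \<le> 1"
      using that by (auto simp: S_def in_cbox_complex_iff abs_square_le_1 abs_le_iff)
    then show ?thesis by (simp add: power2_eq_square) (smt (verit) zero_le_square)
  qed
  have cont: "continuous_on S (f lam)" for lam
  proof -
    \<comment> \<open>The corners 1 and -1 lead to the argument 0, which belongs to the cut;
      continuity there comes from \<open>cmod (csqrt z) = sqrt (cmod z)\<close>.\<close>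
    have csqrt: "continuous (at z within {z. 0 \<le> Re z}) csqrt" if "0 \<le> Re z" for z
    proof (cases "z = 0")
      case True
      have "(csqrt \<longlongrightarrow> 0) (at 0 within {z. 0 \<le> Re z})"
      proof (rule tendsto_norm_zero_cancel)
        have "((\<lambda>z. sqrt (norm z)) \<longlongrightarrow> sqrt (norm (0::complex))) (at 0 within {z. 0 \<le> Re z})"
          by (intro tendsto_intros)
        then show "((\<lambda>z. norm (csqrt z)) \<longlongrightarrow> 0) (at 0 within {z. 0 \<le> Re z})"
          by simp
      qed
      then show ?thesis
        using True by (simp add: continuous_within)
    next
      case False
      with that have "z \<notin> \<real>\<^sub>\<le>\<^sub>0"
        by (auto simp: complex_nonpos_Reals_iff complex_eq_iff)
      then show ?thesis
        by (rule continuous_within_csqrt)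
    qed
    then have "continuous_on {z. 0 \<le> Re z} csqrt"
      by (simp add: continuous_on_eq_continuous_within)
    then have "continuous_on S (\<lambda>z. csqrt (1 - z\<^sup>2))"
      by (rule continuous_on_compose2) (use Re_nonneg in \<open>auto intro!: continuous_intros\<close>)
    then show ?thesis
      unfolding f_def by (intro continuous_on_mult continuous_on_power continuous_intros)
  qed
  have diff: "f lam field_differentiable at z" if "z \<in> interior S" for z lam
  proof -
    have "z \<in> box (-1) (1 + \<i>)"
      using that by (simp add: S_def interior_cbox)
    then have "\<bar>Re z\<bar> < 1" "z \<in> S"
      by (auto simp: in_box_complex_iff S_def in_cbox_complex_iff)
    then have "(Re z)\<^sup>2 < 1"
      by (simp add: abs_square_less_1)
    then have "0 < Re (1 - z\<^sup>2)"
      by (simp add: power2_eq_square) (smt (verit) zero_le_square)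
    then have "1 - z\<^sup>2 \<notin> \<real>\<^sub>\<le>\<^sub>0"
      by (simp add: complex_nonpos_Reals_iff)
    then show ?thesis
      unfolding f_def field_differentiable_def
      by (auto intro!: exI derivative_eq_intros)
  qed
  define side where "side lam a b = contour_integral (linepath a b) (f lam)" for lam a b
  have seg: "closed_segment a b \<subseteq> S" if "a \<in> S" "b \<in> S" for a b
    using that closed_segment_subset[of a S b] convex_box(1) by (simp add: S_def)
  have corners: "-1 \<in> S" "1 \<in> S" "1 + \<i> \<in> S" "-1 + \<i> \<in> S"
    by (auto simp: S_def in_cbox_complex_iff)
  have int: "f lam contour_integrable_on linepath a b" if "a \<in> S" "b \<in> S" for a b lam
    using continuous_on_subset[OF cont seg[OF that]] by (rule contour_integrable_continuous_linepath)
  have closed: "side lam (-1) 1 + side lam 1 (1 + \<i>) + side lam (1 + \<i>) (-1 + \<i>) + side lam (-1 + \<i>) (-1) = 0" for lam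
  proof -
    let ?g = "linepath (-1) 1 +++ linepath 1 (1 + \<i>) +++ linepath (1 + \<i>) (-1 + \<i>) +++ linepath (-1 + \<i>) (-1)"
    have "(f lam has_contour_integral 0) ?g"
    proof (rule Cauchy_theorem_convex[of S _ "{}"])
      show "path_image ?g \<subseteq> S"
        using seg corners by (auto simp: path_image_join)
    qed (use cont diff in \<open>auto simp: S_def convex_box\<close>)
    then have "contour_integral ?g (f lam) = 0"
      by (rule contour_integral_unique)
    then show ?thesis
      using int corners by (simp add: side_def add.assoc)
  qed
  have nrm: "cmod (f lam z) = sqrt (cmod (1 - z\<^sup>2)) ^ k * exp (- (lam * Im z))" for lam z
    by (simp add: f_def norm_mult norm_power)
  have vert: "cmod (side lam a (a + \<i>)) \<le> sqrt 3 ^ k * integral {0..1} (\<lambda>y. exp (- (lam * y)) * sqrt y ^ k)"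
    if a: "a = 1 \<or> a = -1" for lam a
  proof -
    have aS: "a \<in> S" "a + \<i> \<in> S"
      using corners a by auto
    have "(f lam has_contour_integral side lam a (a + \<i>)) (linepath a (a + \<i>))"
      using int[OF aS] unfolding side_def by (rule has_contour_integral_integral)
    then have hi: "((\<lambda>y. f lam (linepath a (a + \<i>) y) * \<i>) has_integral side lam a (a + \<i>)) {0..1}"
      by (simp add: has_contour_integral_linepath)
    have "cmod (f lam (linepath a (a + \<i>) y) * \<i>) \<le> sqrt 3 ^ k * (exp (- (lam * y)) * sqrt y ^ k)"
      if y: "y \<in> {0..1}" for y
    proof -
      have lp: "linepath a (a + \<i>) y = a + \<i> * of_real y"
        by (simp add: linepath_def scaleR_conv_of_real algebra_simps)
      have "a\<^sup>2 = 1" "cmod a = 1"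
        using a by auto
      \<comment> \<open>The constant term \<open>1 - a^2\<close> vanishes. The remaining factor
        \<open>y\<close> is the source of the extra decay of order
        \<open>lam powr (- k / 2)\<close>.\<close>
      then have "1 - (a + \<i> * of_real y)\<^sup>2 = of_real y * (of_real y - 2 * \<i> * a)"
        by (simp add: power2_eq_square algebra_simps)
      also have "cmod \<dots> \<le> y * 3"
      proof -
        have "cmod (of_real y - 2 * \<i> * a) \<le> cmod (of_real y) + cmod (2 * \<i> * a)"
          by (rule norm_triangle_ineq4)
        also have "\<dots> \<le> 3"
          using y \<open>cmod a = 1\<close> by (simp add: norm_mult)
        finally show ?thesis
          using y by (simp add: norm_mult mult_left_mono)
      qed
      finally have "sqrt (cmod (1 - (a + \<i> * of_real y)\<^sup>2)) ^ k \<le> (sqrt (y * 3)) ^ k"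
        by (intro power_mono) auto
      moreover have "Im (a + \<i> * of_real y) = y"
        using a by auto
      ultimately show ?thesis
        unfolding lp norm_mult nrm
        by (simp add: real_sqrt_mult power_mult_distrib mult_ac)
    qed
    moreover have "(\<lambda>y. sqrt 3 ^ k * (exp (- (lam * y)) * sqrt y ^ k)) integrable_on {0..1}"
      by (intro integrable_continuous_interval continuous_intros)
    ultimately have "cmod (integral {0..1} (\<lambda>y. f lam (linepath a (a + \<i>) y) * \<i>)) \<le>
        integral {0..1} (\<lambda>y. sqrt 3 ^ k * (exp (- (lam * y)) * sqrt y ^ k))"
      using hi by (intro integral_norm_bound_integral) (auto simp: has_integral_iff)
    from this[unfolded integral_unique[OF hi]] show ?thesis
      by simp
  qed
  have top: "cmod (side lam (1 + \<i>) (-1 + \<i>)) \<le> 2 * (sqrt 5 ^ k * exp (- lam))" for lam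
  proof -
    have "cmod (side lam (1 + \<i>) (-1 + \<i>)) \<le> (sqrt 5 ^ k * exp (- lam)) * cmod ((-1 + \<i>) - (1 + \<i>))"
      unfolding side_def
    proof (rule contour_integral_bound_linepath[OF int])
      fix z assume "z \<in> closed_segment (1 + \<i>) (-1 + \<i>)"
      then obtain u where u: "0 \<le> u" "u \<le> 1" "z = (1 - u) *\<^sub>R (1 + \<i>) + u *\<^sub>R (-1 + \<i>)"
        by (auto simp: in_segment)
      then have Im: "Im z = 1" and Re: "\<bar>Re z\<bar> \<le> 1"
        unfolding u(3) by auto
      have "cmod z \<le> 2"
        using cmod_le[of z] Im Re by linarith
      then have "cmod (z\<^sup>2) \<le> 2\<^sup>2"
        unfolding norm_power by (intro power_mono) auto
      then have "cmod (1 - z\<^sup>2) \<le> 5"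
        using norm_triangle_ineq4[of 1 "z\<^sup>2"] by simp
      then show "cmod (f lam z) \<le> sqrt 5 ^ k * exp (- lam)"
        unfolding nrm Im by (intro mult_mono power_mono) auto
    qed (use corners in auto)
    also have "cmod ((-1 + \<i>) - (1 + \<i>)) = 2"
      by simp
    finally show ?thesis
      by (simp add: mult_ac)
  qed
  have bottom: "side lam (-1) 1 = integral {-1..1} (\<lambda>t. (sqrt (1 - t\<^sup>2) ^ k) *\<^sub>R cis (lam * t))" for lam
  proof -
    have "side lam (-1) 1 = integral {-1..1} (\<lambda>t. f lam (of_real t))"
      unfolding side_def using contour_integral_linepath_Reals_eq[of "-1" 1 "f lam"] by simp
    also have "\<dots> = integral {-1..1} (\<lambda>t. (sqrt (1 - t\<^sup>2) ^ k) *\<^sub>R cis (lam * t))"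
    proof (rule integral_cong)
      fix t :: real assume "t \<in> {-1..1}"
      then have "t\<^sup>2 \<le> 1"
        by (simp add: abs_square_le_1 abs_le_iff)
      then have "csqrt (1 - (of_real t)\<^sup>2) = of_real (sqrt (1 - t\<^sup>2))"
        using csqrt_of_real_nonneg[of "of_real (1 - t\<^sup>2)"] by simp
      then show "f lam (of_real t) = (sqrt (1 - t\<^sup>2) ^ k) *\<^sub>R cis (lam * t)"
        by (simp add: f_def scaleR_conv_of_real cis_conv_exp mult_ac)
    qed
    finally show ?thesis .
  qed
  define s where "s = real k / 2 + 1"
  have "s > 0"
    by (simp add: s_def add_nonneg_pos)
  \<comment> \<open>The maximum of \<open>lam powr s * exp (- lam)\<close> over positive
    \<open>lam\<close>, attained at \<open>lam = s\<close>. It lets the exponentially small top side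
    be absorbed into the power bound.\<close>
  define D where "D = (s / exp 1) powr s"
  have expD: "exp (- lam) \<le> D * lam powr (- s)" if "lam > 0" for lam
  proof -
    have "1 + ln (lam / s) \<le> lam / s"
      using ln_le_minus_one[of "lam / s"] that \<open>s > 0\<close> by simp
    then have "s * (1 + ln (lam / s)) \<le> lam"
      using \<open>s > 0\<close> by (simp add: field_simps)
    then have "- lam \<le> s * (ln s - 1) - s * ln lam"
      using that \<open>s > 0\<close> by (simp add: ln_div algebra_simps)
    then have "exp (- lam) \<le> exp (s * (ln s - 1)) * exp (- (s * ln lam))"
      by (simp flip: exp_add)
    also have "\<dots> = D * lam powr (- s)"
      using that \<open>s > 0\<close> by (simp add: D_def powr_def ln_div)
    finally show ?thesis .
  qed
  show ?thesis
  proof (intro exI[of _ "2 * (sqrt 3 ^ k * Gamma s) + 2 * (sqrt 5 ^ k * D)"] conjI allI impI)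
    show "0 \<le> 2 * (sqrt 3 ^ k * Gamma s) + 2 * (sqrt 5 ^ k * D)"
      using \<open>s > 0\<close> by (simp add: D_def Gamma_real_pos less_imp_le)
    fix lam :: real assume lam: "lam > 0"
    have v: "sqrt 3 ^ k * integral {0..1} (\<lambda>y. exp (- (lam * y)) * sqrt y ^ k) \<le>
        sqrt 3 ^ k * Gamma s * lam powr (- s)"
      using mult_left_mono[OF integral_exp_sqrt_power_le[OF lam, of k], of "sqrt 3 ^ k"]
      unfolding s_def[symmetric] by (simp add: powr_minus divide_inverse mult.assoc)
    have "side lam (-1) 1 = - side lam 1 (1 + \<i>) - side lam (1 + \<i>) (-1 + \<i>) + side lam (-1) (-1 + \<i>)"
    proof -
      have "side lam (-1 + \<i>) (-1) = - side lam (-1) (-1 + \<i>)"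
        using contour_integral_reverse_linepath[OF continuous_on_subset[OF cont seg], of "-1 + \<i>" "-1" lam] corners
        by (simp add: side_def)
      with closed[of lam] show ?thesis
        by algebra
    qed
    also have "cmod \<dots> \<le> cmod (side lam 1 (1 + \<i>)) + cmod (side lam (1 + \<i>) (-1 + \<i>)) + cmod (side lam (-1) (-1 + \<i>))"
      using norm_triangle_ineq[of "- side lam 1 (1 + \<i>) - side lam (1 + \<i>) (-1 + \<i>)" "side lam (-1) (-1 + \<i>)"]
        norm_triangle_ineq4[of "- side lam 1 (1 + \<i>)" "side lam (1 + \<i>) (-1 + \<i>)"] by simp
    also have "\<dots> \<le> 2 * (sqrt 3 ^ k * Gamma s * lam powr (- s)) + 2 * (sqrt 5 ^ k * (D * lam powr (- s)))"
    proof -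
      have "sqrt 5 ^ k * exp (- lam) \<le> sqrt 5 ^ k * (D * lam powr (- s))"
        using expD[OF lam] by (intro mult_left_mono) auto
      then show ?thesis
        using vert[OF disjI1[OF refl], of lam] vert[OF disjI2[OF refl], of lam] top[of lam] v by linarith
    qed
    also have "\<dots> = (2 * (sqrt 3 ^ k * Gamma s) + 2 * (sqrt 5 ^ k * D)) * lam powr (- s)"
      by (simp add: algebra_simps)
    finally show "cmod (integral {-1..1} (\<lambda>t. (sqrt (1 - t\<^sup>2) ^ k) *\<^sub>R cis (lam * t)))
        \<le> (2 * (sqrt 3 ^ k * Gamma s) + 2 * (sqrt 5 ^ k * D)) * lam powr (- (real k / 2 + 1))"
      unfolding bottom s_def .
  qed
qed

section \<open>The Fejer kernel\<close>

text \<open>Away from the integers this is \<open>sin (pi * M * t)^2 / (M * sin (pi * t)^2)\<close>.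
  The form as a squared modulus makes sense at every \<open>t\<close>, is visibly nonnegative, and
  exhibits a trigonometric polynomial with frequencies below \<open>M\<close> in absolute
  value.\<close>

definition fejer :: "nat \<Rightarrow> real \<Rightarrow> real" where
  "fejer M t = (cmod (\<Sum>j<M. cis (2 * pi * real j * t)))\<^sup>2 / real M"

lemma fejer_nonneg: "0 \<le> fejer M t"
  by (simp add: fejer_def)

lemma continuous_on_fejer: "continuous_on A (fejer M)"
  unfolding fejer_def cis_conv_exp divide_inverse by (intro continuous_intros)

lemma borel_measurable_fejer [measurable]: "fejer M \<in> borel_measurable borel"
  by (rule borel_measurable_continuous_onI[OF continuous_on_fejer])

lemma fejer_add_int: "fejer M (t + of_int m) = fejer M t"
proof -
  have "cis (2 * pi * real j * (t + of_int m)) = cis (2 * pi * real j * t)" for j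
  proof -
    have "cis (2 * pi * real j * (t + of_int m)) = cis (2 * pi * real j * t) * cis (2 * pi * of_int (int j * m))"
      by (simp add: cis_mult algebra_simps)
    also have "cis (2 * pi * of_int (int j * m)) = 1"
      by (intro cis_multiple_2pi) auto
    finally show ?thesis by simp
  qed
  then show ?thesis
    by (simp add: fejer_def)
qed

text \<open>The sum stays indexed by pairs instead of being collected by frequency with weights
  \<open>1 - |n| / M\<close>; all coefficients are then equal, and products over the coordinates
  expand into sums over families of pairs.\<close>

lemma fejer_expand:
  "complex_of_real (fejer M t) =
    (\<Sum>(j, l)\<in>{..<M} \<times> {..<M}. cis (2 * pi * (real j - real l) * t)) / of_nat M"
proof -
  have "complex_of_real (fejer M t) =
      (\<Sum>j<M. cis (2 * pi * real j * t)) * cnj (\<Sum>j<M. cis (2 * pi * real j * t)) / of_nat M"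
    by (simp add: fejer_def complex_norm_square del: of_real_power)
  also have "(\<Sum>j<M. cis (2 * pi * real j * t)) * cnj (\<Sum>j<M. cis (2 * pi * real j * t)) =
      (\<Sum>j<M. \<Sum>l<M. cis (2 * pi * (real j - real l) * t))"
    by (simp add: sum_product cis_cnj cis_mult algebra_simps)
  finally show ?thesis
    by (simp add: sum.cartesian_product)
qed

lemma has_integral_cis_int:
  assumes "n \<in> \<int>" "n \<noteq> 0"
  shows "((\<lambda>t. cis (2 * pi * n * t)) has_integral 0) {-1/2..1/2::real}"
proof -
  define c where "c = \<i> * of_real (2 * pi * n)"
  have "c \<noteq> 0"
    using assms by (simp add: c_def)
  define F where "F t = exp (c * of_real t) / c" for t :: real
  have F: "F t = cis (2 * pi * n * t) / c" for t
    by (simp add: F_def c_def cis_conv_exp mult_ac)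
  have "((\<lambda>t. cis (2 * pi * n * t)) has_integral (F (1/2) - F (-1/2))) {-1/2..1/2}"
  proof (rule fundamental_theorem_of_calculus)
    fix t :: real
    have "((\<lambda>z. exp (c * z) / c) has_field_derivative exp (c * of_real t)) (at (of_real t))"
      using \<open>c \<noteq> 0\<close> by (auto intro!: derivative_eq_intros)
    from has_vector_derivative_real_field[OF this]
    have "(F has_vector_derivative exp (c * of_real t)) (at t within {-1/2..1/2})"
      unfolding F_def by (rule has_vector_derivative_at_within)
    then show "(F has_vector_derivative cis (2 * pi * n * t)) (at t within {-1/2..1/2})"
      by (simp add: c_def cis_conv_exp mult_ac)
  qed auto
  moreover have "cis (2 * pi * n * (1/2)) = cis (2 * pi * n * (-1/2))"
  proof -
    have "cis (2 * pi * n * (1/2)) = cis (2 * pi * n * (-1/2)) * cis (2 * pi * n)"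
      by (simp add: cis_mult)
    then show ?thesis
      using cis_multiple_2pi[of n] assms by simp
  qed
  ultimately show ?thesis
    by (simp add: F)
qed

lemma has_integral_fejer:
  assumes "M > 0"
  shows "(fejer M has_integral 1) {-1/2..1/2}"
proof -
  have "((\<lambda>t. \<Sum>(j, l)\<in>{..<M} \<times> {..<M}. cis (2 * pi * (real j - real l) * t)) has_integral
      (\<Sum>(j, l)\<in>{..<M} \<times> {..<M}. if j = l then 1 else 0)) {-1/2..1/2}"
    unfolding case_prod_unfold
  proof (rule has_integral_sum)
    fix p :: "nat \<times> nat"
    show "((\<lambda>t. cis (2 * pi * (real (fst p) - real (snd p)) * t)) has_integral
        (if fst p = snd p then 1 else 0)) {-1/2..1/2}"
      using has_integral_cis_int[of "real (fst p) - real (snd p)"]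
        has_integral_const_real[of "1::complex" "-1/2" "1/2"] by auto
  qed auto
  also have "(\<Sum>(j, l)\<in>{..<M} \<times> {..<M}. if j = l then 1 else 0 :: complex) = of_nat M"
    by (simp add: sum.cartesian_product[symmetric])
  finally have "((\<lambda>t. (\<Sum>(j, l)\<in>{..<M} \<times> {..<M}. cis (2 * pi * (real j - real l) * t)) / of_nat M)
      has_integral of_nat M / of_nat M) {-1/2..1/2}"
    by (rule has_integral_divide)
  then have "((\<lambda>t. complex_of_real (fejer M t)) has_integral 1) {-1/2..1/2}"
    using assms by (simp add: fejer_expand)
  from has_integral_linear[OF this bounded_linear_Re] show ?thesis
    by (simp add: o_def)
qed

text \<open>In the geometric sum the numerator is at most 2 in modulus, while the denominator is
  \<open>2 * |sin (pi * t)| \<ge> 4 * |t|\<close> by concavity of the sine on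
  \<open>[0, pi / 2]\<close>.\<close>

lemma fejer_le:
  assumes "M > 0" "0 < \<bar>t\<bar>" "\<bar>t\<bar> \<le> 1/2"
  shows "fejer M t \<le> 1 / (4 * real M * t\<^sup>2)"
proof -
  have sin: "2 * \<bar>t\<bar> \<le> \<bar>sin (pi * t)\<bar>"
  proof -
    have "convex_on {0..pi/2} (\<lambda>x. - sin x)"
    proof (rule f''_ge0_imp_convex)
      show "((\<lambda>x. - sin x) has_real_derivative - cos x) (at x)" for x
        by (auto intro!: derivative_eq_intros)
      show "((\<lambda>x. - cos x) has_real_derivative sin x) (at x)" for x
        by (auto intro!: derivative_eq_intros)
    qed (auto intro!: sin_ge_zero)
    then have "- sin ((1 - 2 * \<bar>t\<bar>) *\<^sub>R 0 + (2 * \<bar>t\<bar>) *\<^sub>R (pi / 2)) \<le>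
        (1 - 2 * \<bar>t\<bar>) * - sin 0 + (2 * \<bar>t\<bar>) * - sin (pi / 2)"
      using assms by (intro convex_onD) auto
    then have "2 * \<bar>t\<bar> \<le> sin (pi * \<bar>t\<bar>)"
      by (simp add: mult.commute)
    also have "\<dots> \<le> \<bar>sin (pi * t)\<bar>"
      by (cases "t \<ge> 0") auto
    finally show ?thesis .
  qed
  have "cmod (cis (2 * pi * t) - 1) = 2 * \<bar>sin (pi * t)\<bar>"
    using dist_exp_i_1[of "2 * pi * t"] by (simp add: cis_conv_exp)
  with sin have ge: "4 * \<bar>t\<bar> \<le> cmod (cis (2 * pi * t) - 1)"
    by simp
  with assms have "cis (2 * pi * t) \<noteq> 1"
    by auto
  moreover have "cis (2 * pi * real j * t) = cis (2 * pi * t) ^ j" for j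
    by (simp add: Complex.DeMoivre mult_ac)
  ultimately have "(\<Sum>j<M. cis (2 * pi * real j * t)) = (cis (2 * pi * t) ^ M - 1) / (cis (2 * pi * t) - 1)"
    using geometric_sum[of "cis (2 * pi * t)" M] by simp
  also have "cmod \<dots> \<le> 2 / (4 * \<bar>t\<bar>)"
    unfolding norm_divide
  proof (rule frac_le)
    show "cmod (cis (2 * pi * t) ^ M - 1) \<le> 2"
      using norm_triangle_ineq4[of "cis (2 * pi * t) ^ M" 1] by (simp add: norm_power)
  qed (use assms ge in auto)
  finally have "(cmod (\<Sum>j<M. cis (2 * pi * real j * t)))\<^sup>2 \<le> (2 / (4 * \<bar>t\<bar>))\<^sup>2"
    by (intro power_mono) auto
  then have "fejer M t \<le> (2 / (4 * \<bar>t\<bar>))\<^sup>2 / real M"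
    unfolding fejer_def by (rule divide_right_mono) simp
  also have "\<dots> = 1 / (4 * real M * t\<^sup>2)"
    by (simp add: power2_eq_square field_simps)
  finally show ?thesis .
qed

lemma nn_integral_fejer:
  assumes "M > 0"
  shows "(\<integral>\<^sup>+t. ennreal (indicator {-1/2..<1/2} t * fejer M t) \<partial>lborel) = 1"
proof -
  have "(\<integral>\<^sup>+t. ennreal (indicator {-1/2..<1/2} t * fejer M t) \<partial>lborel) =
      (\<integral>\<^sup>+t. ennreal (indicator {-1/2..1/2} t * fejer M t) \<partial>lborel)"
  proof (rule nn_integral_cong_AE)
    have "AE t in lborel. t \<noteq> (1/2::real)"
      by (rule AE_lborel_singleton)
    then show "AE t in lborel. ennreal (indicator {-1/2..<1/2} t * fejer M t) =
        ennreal (indicator {-1/2..1/2} t * fejer M t)"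
      by eventually_elim (auto simp: indicator_def)
  qed
  also have "\<dots> = ennreal 1"
    using nn_integral_has_integral_lebesgue[OF _ has_integral_fejer[OF assms]] fejer_nonneg
    by simp
  finally show ?thesis by simp
qed

text \<open>Integrating the pointwise bound over both sides and dropping the contributions of the
  outer endpoints. For \<open>c\<close> a multiple of \<open>1 / M\<close> the result is a constant,
  which can be made small but does not decay.\<close>

lemma nn_integral_fejer_tail:
  assumes "M > 0" "c > 0"
  shows "(\<integral>\<^sup>+t. ennreal (indicator {-1/2..<1/2} t * indicator {t. c < \<bar>t\<bar>} t * fejer M t) \<partial>lborel) \<le>
    ennreal (1 / (2 * real M * c))"
proof (cases "c < 1/2")
  case False
  then have "indicator {-1/2..<1/2} t * indicator {t. c < \<bar>t\<bar>} t * fejer M t = 0" for t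
    by (auto simp: indicator_def)
  then show ?thesis
    by (simp only:) simp
next
  case True
  define g where "g t = 1 / (4 * real M * t\<^sup>2)" for t
  define G where "G t = - 1 / (4 * real M * t)" for t
  have int: "(g has_integral (G b - G a)) {a..b}" if "a \<le> b" "0 \<notin> {a..b}" for a b
  proof (rule fundamental_theorem_of_calculus)
    fix x assume "x \<in> {a..b}"
    with that have "x \<noteq> 0" by auto
    then have "(G has_real_derivative g x) (at x)"
      using assms unfolding G_def g_def
      by (auto intro!: derivative_eq_intros simp: power2_eq_square field_simps)
    then show "(G has_vector_derivative g x) (at x within {a..b})"
      by (simp add: has_real_derivative_iff_has_vector_derivative has_vector_derivative_at_within)
  qed fact
  have g0: "0 \<le> g t" for t
    by (simp add: g_def)
  have [measurable]: "g \<in> borel_measurable borel"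
    unfolding g_def by measurable
  have "(\<integral>\<^sup>+t. ennreal (indicator {-1/2..<1/2} t * indicator {t. c < \<bar>t\<bar>} t * fejer M t) \<partial>lborel) \<le>
      (\<integral>\<^sup>+t. ennreal (indicator {-1/2..-c} t * g t) + ennreal (indicator {c..1/2} t * g t) \<partial>lborel)"
  proof (rule nn_integral_mono)
    fix t :: real
    show "ennreal (indicator {-1/2..<1/2} t * indicator {t. c < \<bar>t\<bar>} t * fejer M t) \<le>
        ennreal (indicator {-1/2..-c} t * g t) + ennreal (indicator {c..1/2} t * g t)"
    proof (cases "t \<in> {-1/2..<1/2} \<and> c < \<bar>t\<bar>")
      case True
      then have "fejer M t \<le> g t"
        unfolding g_def using assms by (intro fejer_le) auto
      then show ?thesis
        using True g0 assms by (auto simp: indicator_def abs_if ennreal_leI split: if_splits)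
    qed (auto simp: indicator_def)
  qed
  also have "\<dots> = (\<integral>\<^sup>+t. ennreal (indicator {-1/2..-c} t * g t) \<partial>lborel) + (\<integral>\<^sup>+t. ennreal (indicator {c..1/2} t * g t) \<partial>lborel)"
    by (rule nn_integral_add) auto
  also have "\<dots> = ennreal (G (-c) - G (-1/2)) + ennreal (G (1/2) - G c)"
    using nn_integral_has_integral_lebesgue[OF g0 int[of "-1/2" "-c"]]
      nn_integral_has_integral_lebesgue[OF g0 int[of c "1/2"]] assms True by simp
  also have "\<dots> \<le> ennreal (1 / (4 * real M * c)) + ennreal (1 / (4 * real M * c))"
    using assms by (intro add_mono ennreal_leI) (auto simp: G_def)
  also have "\<dots> = ennreal (1 / (2 * real M * c))"
    using assms by (simp flip: ennreal_plus)
  finally show ?thesis .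
qed

section \<open>Power sums over one-dimensional frequencies\<close>

lemma sum_powr_minus_le:
  fixes g :: real
  assumes "0 < g" "g < 1"
  shows "(\<Sum>k=1..N. real k powr (- g)) \<le> real N powr (1 - g) / (1 - g)"
proof (induction N)
  case (Suc N)
  have "(1 - g) * real (Suc N) powr (- g) \<le> real (Suc N) powr (1 - g) - real N powr (1 - g)"
  proof -
    \<comment> \<open>Weighted AM-GM; divided by \<open>real (Suc N) powr g\<close> it says that the
      increment of the concave power \<open>1 - g\<close> is at least its derivative at the right
      endpoint.\<close>
    have y: "real N powr (1 - g) * real (Suc N) powr g \<le> (1 - g) * real N + g * real (Suc N)"
    proof (cases "N = 0")
      case False
      then show ?thesis
        using assms by (intro Youngs_inequality_0) auto
    qed (use assms in auto)
    have p: "real (Suc N) powr (1 - g) * real (Suc N) powr g = real (Suc N)"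
      "real (Suc N) powr (- g) * real (Suc N) powr g = 1"
      by (simp_all flip: powr_add)
    have "real N powr (1 - g) * real (Suc N) powr g + (1 - g) * (real (Suc N) powr (- g) * real (Suc N) powr g)
        \<le> real (Suc N) powr (1 - g) * real (Suc N) powr g"
      unfolding p using y by (simp add: algebra_simps)
    then have "(real N powr (1 - g) + (1 - g) * real (Suc N) powr (- g)) * real (Suc N) powr g
        \<le> real (Suc N) powr (1 - g) * real (Suc N) powr g"
      by (simp add: algebra_simps)
    then have "real N powr (1 - g) + (1 - g) * real (Suc N) powr (- g) \<le> real (Suc N) powr (1 - g)"
      by (rule mult_right_le_imp_le) simp
    then show ?thesis by simp
  qed
  then have "real (Suc N) powr (- g) \<le> (real (Suc N) powr (1 - g) - real N powr (1 - g)) / (1 - g)"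
    using assms by (simp add: field_simps)
  then show ?case
    using Suc by (simp add: diff_divide_distrib)
qed simp

text \<open>For fixed \<open>l\<close> the differences on either side of \<open>l\<close> are
  distinct integers between 1 and \<open>M\<close>, so each side costs one power sum, and averaging
  over \<open>l\<close> cancels \<open>M\<close>. The \<open>max 1\<close> gives the diagonal weight
  1, where \<open>0 powr (- g)\<close> would be 0.\<close>

lemma sum_diff_powr_le:
  fixes g :: real
  assumes "0 < g" "g < 1" "M > 0"
  shows "(\<Sum>(j, l)\<in>{..<M} \<times> {..<M}. max 1 \<bar>real j - real l\<bar> powr (- g)) / real M
    \<le> (1 + 2 / (1 - g)) * real M powr (1 - g)"
proof -
  let ?S = "\<Sum>k=1..M. real k powr (- g)"
  have "(\<Sum>j<M. max 1 \<bar>real j - real l\<bar> powr (- g)) \<le> 1 + 2 * ?S" if "l < M" for l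
  proof -
    have "{..<M} = {..<l} \<union> ({l} \<union> {l<..<M})"
      using that by auto
    then have "(\<Sum>j<M. max 1 \<bar>real j - real l\<bar> powr (- g)) =
        (\<Sum>j\<in>{..<l} \<union> ({l} \<union> {l<..<M}). max 1 \<bar>real j - real l\<bar> powr (- g))"
      by simp
    also have "\<dots> = (\<Sum>j<l. max 1 \<bar>real j - real l\<bar> powr (- g)) +
        (1 + (\<Sum>j\<in>{l<..<M}. max 1 \<bar>real j - real l\<bar> powr (- g)))"
      by (subst sum.union_disjoint, (auto)[3], subst sum.union_disjoint) auto
    also have "(\<Sum>j<l. max 1 \<bar>real j - real l\<bar> powr (- g)) = (\<Sum>k=1..l. real k powr (- g))"
      by (rule sum.reindex_bij_witness[of _ "\<lambda>k. l - k" "\<lambda>j. l - j"]) (auto simp: of_nat_diff max_def)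
    also have "\<dots> \<le> ?S"
      using that by (intro sum_mono2) auto
    also have "(\<Sum>j\<in>{l<..<M}. max 1 \<bar>real j - real l\<bar> powr (- g)) = (\<Sum>k\<in>{1..<M - l}. real k powr (- g))"
      by (rule sum.reindex_bij_witness[of _ "\<lambda>k. l + k" "\<lambda>j. j - l"]) (auto simp: of_nat_diff max_def)
    also have "\<dots> \<le> ?S"
      by (intro sum_mono2) auto
    finally show ?thesis by simp
  qed
  then have "(\<Sum>l<M. \<Sum>j<M. max 1 \<bar>real j - real l\<bar> powr (- g)) \<le> (\<Sum>l<M. 1 + 2 * ?S)"
    by (intro sum_mono) auto
  then have "(\<Sum>(j, l)\<in>{..<M} \<times> {..<M}. max 1 \<bar>real j - real l\<bar> powr (- g)) \<le> real M * (1 + 2 * ?S)"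
    by (subst (asm) sum.swap) (simp add: sum.cartesian_product)
  then have "(\<Sum>(j, l)\<in>{..<M} \<times> {..<M}. max 1 \<bar>real j - real l\<bar> powr (- g)) / real M \<le> 1 + 2 * ?S"
    using assms by (simp add: field_simps)
  also have "\<dots> \<le> 1 * real M powr (1 - g) + 2 * (real M powr (1 - g) / (1 - g))"
    using assms sum_powr_minus_le[OF assms(1,2), of M] by (intro add_mono) (auto simp: ge_one_powr_ge_zero)
  finally show ?thesis
    by (simp add: algebra_simps)
qed

section \<open>Fourier transform of an ellipsoid\<close>

definition int_vec :: "('n::finite \<Rightarrow> int) \<Rightarrow> real ^ 'n" where
  "int_vec m = (\<chi> i. of_int (m i))"

lemma int_vec_nth [simp]: "int_vec m $ i = of_int (m i)"
  by (simp add: int_vec_def)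

lemma borel_measurable_vec_component [measurable (raw)]:
  fixes f :: "'a \<Rightarrow> real ^ 'n"
  assumes "f \<in> borel_measurable M"
  shows "(\<lambda>x. f x $ i) \<in> borel_measurable M"
  using borel_measurable_inner[OF assms borel_measurable_const[of "axis i 1"]] by (simp add: inner_axis)

text \<open>The slices carry the weight \<open>sqrt (1 - t^2) ^ (d - 1)\<close>, so the oscillatory
  integral with \<open>k = d - 1\<close> yields the exponent
  \<open>(d - 1) / 2 + 1 = (d + 1) / 2\<close>. Frequencies along the axes suffice, since a rotation
  will bring any frequency there.\<close>

lemma fourier_ball_bound:
  "\<exists>C\<ge>0. \<forall>lam>0. \<forall>k::'n.
     cmod (\<integral>y. indicator (ball 0 1 :: (real ^ 'n) set) y *\<^sub>R cis (lam * y $ k) \<partial>lborel)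
       \<le> C * lam powr (- ((real CARD('n) + 1) / 2))"
proof -
  let ?d = "CARD('n)"
  have d: "1 \<le> ?d"
    by (simp add: Suc_leI)
  obtain C where C: "C \<ge> 0" "\<And>lam. lam > 0 \<Longrightarrow>
      cmod (integral {-1..1} (\<lambda>t. (sqrt (1 - t\<^sup>2) ^ (?d - 1)) *\<^sub>R cis (lam * t)))
        \<le> C * lam powr (- (real (?d - 1) / 2 + 1))"
    using oscillatory_integral_bound[of "?d - 1"] by blast
  have "cmod (\<integral>y. indicator (ball 0 1 :: (real ^ 'n) set) y *\<^sub>R cis (lam * y $ k) \<partial>lborel)
       \<le> unit_ball_vol (real (?d - 1)) * C * lam powr (- ((real ?d + 1) / 2))" if "lam > 0" for lam and k :: 'n
  proof -
    let ?f = "\<lambda>t. (sqrt (1 - t\<^sup>2) ^ (?d - 1)) *\<^sub>R cis (lam * t)"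
    have "(\<integral>y. indicator (ball 0 1 :: (real ^ 'n) set) y *\<^sub>R cis (lam * y $ k) \<partial>lborel) =
        (\<integral>y. indicator (ball 0 1 :: (real ^ 'n) set) y *\<^sub>R cis (lam * (y \<bullet> axis k 1)) \<partial>lborel)"
      by (simp add: inner_axis)
    also have "\<dots> = unit_ball_vol (?d - 1) *\<^sub>R (\<integral>t. indicator {-1..1} t *\<^sub>R ?f t \<partial>lborel)"
      by (subst integral_ball_inner_Basis[of "axis k 1 :: real ^ 'n" "\<lambda>t. cis (lam * t)"])
         (auto simp: cis_conv_exp)
    also have "(\<integral>t. indicator {-1..1} t *\<^sub>R ?f t \<partial>lborel) = integral {-1..1} ?f"
    proof -
      have "set_integrable lborel {-1..1} ?f"
        unfolding cis_conv_exp by (intro borel_integrable_atLeastAtMost' continuous_intros)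
      from set_borel_integral_eq_integral(2)[OF this] show ?thesis
        by (simp add: set_lebesgue_integral_def)
    qed
    also have "cmod (unit_ball_vol (?d - 1) *\<^sub>R integral {-1..1} ?f) \<le>
        unit_ball_vol (?d - 1) * (C * lam powr (- (real (?d - 1) / 2 + 1)))"
      using C(2)[OF that] by (simp add: mult_left_mono)
    also have "real (?d - 1) / 2 + 1 = (real ?d + 1) / 2"
      using d by (simp add: of_nat_diff field_simps)
    finally show ?thesis
      by (simp add: mult.assoc)
  qed
  then show ?thesis
    using C(1) by (intro exI[of _ "unit_ball_vol (real (?d - 1)) * C"]) auto
qed

lemma sets_ellipsoid [measurable]:
  fixes L :: "real ^ 'n ^ 'm"
  shows "{z. norm (L *v z) < R} \<in> sets borel" "{z. norm (L *v (x + z)) < R} \<in> sets borel"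
proof -
  have "continuous_on UNIV (\<lambda>z. L *v (y + z))" for y
    by (intro continuous_on_compose2[OF matrix_vector_mult_linear_continuous_on[of UNIV L]] continuous_intros) auto
  then have "open {z. norm (L *v (y + z)) < R}" for y
    by (intro open_Collect_less continuous_intros)
  from this[of 0] this[of x] show "{z. norm (L *v z) < R} \<in> sets borel"
      "{z. norm (L *v (x + z)) < R} \<in> sets borel"
    by simp_all
qed

text \<open>The vector \<open>w\<close> is the inverse transpose of \<open>L\<close> applied to
  \<open>n\<close>, a point of the dual lattice when \<open>n\<close> is integral. It is handed over
  through its pairing with \<open>L *v z\<close>, from which its length will be bounded
  below.\<close>

lemma fourier_ellipsoid:
  fixes L :: "real ^ 'n ^ 'n" and n x :: "real ^ 'n"
  assumes L: "invertible L" and R: "R > 0"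
  obtains w where "\<And>z. w \<bullet> (L *v z) = n \<bullet> z"
    "\<And>k. cmod (\<integral>z. indicator {z. norm (L *v (x + z)) < R} z *\<^sub>R cis (2 * pi * (n \<bullet> z)) \<partial>lborel) =
      R ^ CARD('n) / \<bar>det L\<bar> *
      cmod (\<integral>y. indicator (ball 0 1 :: (real ^ 'n) set) y *\<^sub>R cis (2 * pi * norm w * R * y $ k) \<partial>lborel)"
proof -
  obtain L' where L': "L ** L' = mat 1" "L' ** L = mat 1"
    using L unfolding invertible_def by blast
  define w where "w = transpose L' *v n"
  have w: "w \<bullet> (L *v z) = n \<bullet> z" for z
  proof -
    have "w \<bullet> (L *v z) = n \<bullet> (L' *v (L *v z))"
      unfolding w_def by (simp add: dot_lmul_matrix)
    then show ?thesis
      by (simp add: matrix_vector_mul_assoc L')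
  qed
  have eq: "cmod (\<integral>z. indicator {z. norm (L *v (x + z)) < R} z *\<^sub>R cis (2 * pi * (n \<bullet> z)) \<partial>lborel) =
      R ^ CARD('n) / \<bar>det L\<bar> *
      cmod (\<integral>y. indicator (ball 0 1 :: (real ^ 'n) set) y *\<^sub>R cis (2 * pi * norm w * R * y $ k) \<partial>lborel)"
    (is "cmod ?I = _ * cmod ?J") for k
  proof -
    have "norm w = norm (norm w *\<^sub>R axis k 1 :: real ^ 'n)"
      by simp
    then obtain U :: "real ^ 'n \<Rightarrow> real ^ 'n" where U: "orthogonal_transformation U" "U w = norm w *\<^sub>R axis k 1"
      by (rule orthogonal_transformation_exists)
    \<comment> \<open>\<open>f\<close> carries the centred ellipsoid onto the unit ball and, as
      \<open>U\<close> turns \<open>w\<close> onto the axis \<open>k\<close>, makes the phase a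
      multiple of the \<open>k\<close>-th coordinate.\<close>
    define f where "f z = (1 / R) *\<^sub>R U (L *v z)" for z
    have lin: "linear f"
      unfolding f_def using orthogonal_transformation_linear[OF U(1)]
      by (intro linear_compose_scale_right linear_compose[unfolded o_def, of "(*v) L" U]) auto
    have det: "\<bar>det (matrix f)\<bar> = \<bar>det L\<bar> / R ^ CARD('n)"
    proof -
      have "f = (*\<^sub>R) (1 / R) \<circ> (U \<circ> (*v) L)"
        by (simp add: f_def fun_eq_iff)
      then have "matrix f = matrix ((*\<^sub>R) (1 / R)) ** (matrix U ** L)"
        using orthogonal_transformation_linear[OF U(1)]
        by (simp add: matrix_compose linear_compose matrix_of_matrix_vector_mul)
      then have "det (matrix f) = (1 / R) ^ CARD('n) * (det (matrix U) * det L)"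
        by (simp add: det_mul det_matrix_scaleR)
      moreover have "\<bar>det (matrix U)\<bar> = 1"
        using U(1) by simp
      ultimately show ?thesis
        using R by (simp add: abs_mult power_divide)
    qed
    have det0: "det (matrix f) \<noteq> 0"
      using det L R by (auto simp: invertible_det_nz)
    have f_ball: "f z \<in> ball 0 1 \<longleftrightarrow> norm (L *v z) < R" for z
      using R orthogonal_transformation_norm[OF U(1)] by (simp add: f_def field_simps)
    have f_k: "norm w * R * f z $ k = n \<bullet> z" for z
    proof -
      have "n \<bullet> z = U w \<bullet> U (L *v z)"
        using U(1) by (simp add: orthogonal_transformation_def w)
      also have "\<dots> = norm w * U (L *v z) $ k"
        by (simp add: U(2) inner_axis' )
      finally show ?thesis
        using R by (simp add: f_def)
    qed
    \<comment> \<open>Centring the ellipsoid costs only a factor of modulus 1; this is what makes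
      the later bounds uniform in \<open>x\<close>.\<close>
    have shift: "cis (2 * pi * (n \<bullet> (- x + z))) = cis (- (2 * pi * (n \<bullet> x))) * cis (2 * pi * (n \<bullet> z))" for z
      by (simp add: cis_mult inner_diff_right right_diff_distrib)
    have sets_ball[measurable]: "ball (0 :: real ^ 'n) 1 \<in> sets borel"
      by simp
    have "?I = (\<integral>z. indicator {z. norm (L *v (x + z)) < R} z *\<^sub>R cis (2 * pi * (n \<bullet> z)) \<partial>distr lborel borel ((+) (- x)))"
      by (simp only: lborel_distr_plus)
    also have "\<dots> = (\<integral>z. indicator {z. norm (L *v (x + z)) < R} (- x + z) *\<^sub>R cis (2 * pi * (n \<bullet> (- x + z))) \<partial>lborel)"
      by (rule integral_distr) (simp_all add: cis_conv_exp)
    also have "\<dots> = (\<integral>z. cis (- (2 * pi * (n \<bullet> x))) * (indicator {z. norm (L *v z) < R} z *\<^sub>R cis (2 * pi * (n \<bullet> z))) \<partial>lborel)"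
      unfolding shift mult_scaleR_right by (intro Bochner_Integration.integral_cong) (simp_all add: indicator_def)
    also have "cmod \<dots> = cmod (\<integral>z. indicator {z. norm (L *v z) < R} z *\<^sub>R cis (2 * pi * (n \<bullet> z)) \<partial>lborel)"
      by (simp only: integral_mult_right_zero norm_mult norm_cis mult_1)
    also have "(\<integral>z. indicator {z. norm (L *v z) < R} z *\<^sub>R cis (2 * pi * (n \<bullet> z)) \<partial>lborel) =
        (\<integral>z. indicator (ball 0 1) (f z) *\<^sub>R cis (2 * pi * norm w * R * f z $ k) \<partial>lborel)"
    proof (intro Bochner_Integration.integral_cong refl)
      fix z
      have "2 * pi * norm w * R * f z $ k = 2 * pi * (n \<bullet> z)"
        by (simp add: f_k[symmetric])
      then show "indicator {z. norm (L *v z) < R} z *\<^sub>R cis (2 * pi * (n \<bullet> z)) =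
          indicator (ball 0 1) (f z) *\<^sub>R cis (2 * pi * norm w * R * f z $ k)"
        by (simp only: indicator_def f_ball mem_Collect_eq)
    qed
    also have "\<dots> = (1 / \<bar>det (matrix f)\<bar>) *\<^sub>R ?J"
      by (intro integral_lborel_linear[OF lin det0]) (simp_all add: cis_conv_exp)
    finally show ?thesis
      using R by (simp add: det abs_of_nonneg)
  qed
  show thesis
    by (rule that[OF w eq])
qed

lemma emeasure_ellipsoid:
  fixes L :: "real ^ 'n ^ 'n" and x :: "real ^ 'n"
  assumes L: "invertible L" and R: "R > 0"
  shows "emeasure lborel {z. norm (L *v (x + z)) < R} = ennreal (unit_ball_vol (real CARD('n)) * R ^ CARD('n) / \<bar>det L\<bar>)"
proof -
  let ?S = "\<lambda>x. {z. norm (L *v (x + z)) < R}"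
  have [measurable]: "ball (0 :: real ^ 'n) R \<in> sets borel"
    by simp
  have "emeasure lborel (?S x) = (\<integral>\<^sup>+z. indicator (?S x) z \<partial>distr lborel borel ((+) (- x)))"
    by (simp add: lborel_distr_plus)
  also have "\<dots> = (\<integral>\<^sup>+z. indicator (ball 0 R) (L *v z) \<partial>lborel)"
    by (subst nn_integral_distr) (auto simp: indicator_def)
  also have "\<dots> = ((\<integral>\<^sup>+z. indicator (ball 0 R) (L *v z) \<partial>lborel) * ennreal \<bar>det L\<bar>) * ennreal (1 / \<bar>det L\<bar>)"
    using L by (simp add: mult.assoc invertible_det_nz flip: ennreal_mult')
  also have "(\<integral>\<^sup>+z. indicator (ball 0 R) (L *v z) \<partial>lborel) * ennreal \<bar>det L\<bar> = (\<integral>\<^sup>+z. indicator (ball 0 R :: (real ^ 'n) set) z \<partial>lborel)"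
    using nn_integral_lborel_linear[of "(*v) L" "indicator (ball 0 R)"] L
    by (simp add: matrix_of_matrix_vector_mul invertible_det_nz)
  also have "\<dots> = ennreal (unit_ball_vol (real CARD('n)) * R ^ CARD('n))"
    using R by (simp add: emeasure_ball)
  finally show "emeasure lborel (?S x) = ennreal (unit_ball_vol (real CARD('n)) * R ^ CARD('n) / \<bar>det L\<bar>)"
    using R by (simp flip: ennreal_mult')
qed

text \<open>Cauchy-Schwarz applied to \<open>m i = w \<bullet> column i L\<close> gives
  \<open>norm w \<ge> |m i| / r\<close>. Any nonzero coordinate may be used for \<open>i\<close>, so
  the largest one can be chosen later.\<close>

lemma fourier_ellipsoid_bound:
  "\<exists>C\<ge>0. \<forall>(L :: real ^ 'n ^ 'n) (m :: 'n \<Rightarrow> int) x (r::real) (R::real) i.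
     invertible L \<longrightarrow> R > 0 \<longrightarrow> r > 0 \<longrightarrow> norm (column i L) \<le> r \<longrightarrow> m i \<noteq> 0 \<longrightarrow>
     cmod (\<integral>z. indicator {z. norm (L *v (x + z)) < R} z *\<^sub>R cis (2 * pi * (int_vec m \<bullet> z)) \<partial>lborel)
       \<le> C / \<bar>det L\<bar> * R powr ((real CARD('n) - 1) / 2) * r powr ((real CARD('n) + 1) / 2) *
         \<bar>of_int (m i)\<bar> powr (- ((real CARD('n) + 1) / 2))"
proof -
  let ?d = "real CARD('n)"
  let ?e = "(?d + 1) / 2"
  obtain C where C: "C \<ge> 0" "\<And>lam k. lam > 0 \<Longrightarrow>
      cmod (\<integral>y. indicator (ball 0 1 :: (real ^ 'n) set) y *\<^sub>R cis (lam * y $ k) \<partial>lborel) \<le> C * lam powr (- ?e)"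
    using fourier_ball_bound[where 'n = 'n] by blast
  show ?thesis
  proof (intro exI[of _ C] conjI allI impI C(1))
    fix L :: "real ^ 'n ^ 'n" and m :: "'n \<Rightarrow> int" and x :: "real ^ 'n" and r R :: real and i
    assume A: "invertible L" "R > 0" "r > 0" "norm (column i L) \<le> r" "m i \<noteq> 0"
    obtain w where w: "\<And>z. w \<bullet> (L *v z) = int_vec m \<bullet> z"
      "\<And>k. cmod (\<integral>z. indicator {z. norm (L *v (x + z)) < R} z *\<^sub>R cis (2 * pi * (int_vec m \<bullet> z)) \<partial>lborel) =
      R ^ CARD('n) / \<bar>det L\<bar> *
      cmod (\<integral>y. indicator (ball 0 1 :: (real ^ 'n) set) y *\<^sub>R cis (2 * pi * norm w * R * y $ k) \<partial>lborel)"
      using fourier_ellipsoid[OF A(1,2), of "int_vec m" x] by blast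
    have "of_int (m i) = w \<bullet> (L *v axis i 1)"
      by (simp add: w inner_axis)
    then have "of_int (m i) = w \<bullet> column i L"
      by (simp add: matrix_vector_mult_basis)
    then have "\<bar>of_int (m i)\<bar> \<le> norm w * norm (column i L)"
      by (metis Cauchy_Schwarz_ineq2)
    also have "\<dots> \<le> norm w * r"
      using A by (intro mult_left_mono) auto
    finally have mw: "\<bar>of_int (m i)\<bar> / r \<le> norm w"
      using A by (simp add: field_simps)
    have mpos: "\<bar>of_int (m i)\<bar> > (0::real)"
      using A by simp
    with A have "0 < \<bar>of_int (m i)\<bar> / r"
      by simp
    with mw have wpos: "0 < norm w"
      by linarith
    have "1 * (\<bar>of_int (m i)\<bar> / r * R) \<le> (2 * pi) * (norm w * R)"
      using A mw pi_ge_two by (intro mult_mono mult_right_mono) auto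
    then have "(2 * pi * norm w * R) powr (- ?e) \<le> (\<bar>of_int (m i)\<bar> / r * R) powr (- ?e)"
      using A mpos by (intro powr_mono2') auto
    also have "\<dots> = R powr (- ?e) * r powr ?e * \<bar>of_int (m i)\<bar> powr (- ?e)"
      using A mpos by (simp add: powr_mult powr_divide powr_minus field_simps)
    finally have "C * (2 * pi * norm w * R) powr (- ?e) \<le> C * (R powr (- ?e) * r powr ?e * \<bar>of_int (m i)\<bar> powr (- ?e))"
      using C(1) by (rule mult_left_mono)
    then have "cmod (\<integral>y. indicator (ball 0 1 :: (real ^ 'n) set) y *\<^sub>R cis (2 * pi * norm w * R * y $ k) \<partial>lborel)
        \<le> C * (R powr (- ?e) * r powr ?e * \<bar>of_int (m i)\<bar> powr (- ?e))" for k
      using C(2)[of "2 * pi * norm w * R" k] A wpos by (auto intro: order_trans)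
    note bound = this[of i]
    have "cmod (\<integral>z. indicator {z. norm (L *v (x + z)) < R} z *\<^sub>R cis (2 * pi * (int_vec m \<bullet> z)) \<partial>lborel)
        \<le> R ^ CARD('n) / \<bar>det L\<bar> * (C * (R powr (- ?e) * r powr ?e * \<bar>of_int (m i)\<bar> powr (- ?e)))"
      unfolding w(2)[of i] using A bound by (intro mult_left_mono) auto
    also have "\<dots> = C / \<bar>det L\<bar> * (R ^ CARD('n) * R powr (- ?e)) * r powr ?e * \<bar>of_int (m i)\<bar> powr (- ?e)"
      by simp
    also have "R ^ CARD('n) * R powr (- ?e) = R powr ((?d - 1) / 2)"
      using A by (simp add: field_simps flip: powr_realpow powr_add)
    finally show "cmod (\<integral>z. indicator {z. norm (L *v (x + z)) < R} z *\<^sub>R cis (2 * pi * (int_vec m \<bullet> z)) \<partial>lborel)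
       \<le> C / \<bar>det L\<bar> * R powr ((?d - 1) / 2) * r powr ?e * \<bar>of_int (m i)\<bar> powr (- ?e)" .
  qed
qed

section \<open>Smoothed lattice point counts\<close>

definition fejer_vec :: "nat \<Rightarrow> real ^ 'n \<Rightarrow> real" where
  "fejer_vec M u = (\<Prod>i\<in>UNIV. fejer M (u $ i))"

text \<open>Half-open, so that the integer translates tile space exactly; centred, so that the
  kernel concentrates in the middle of the cube.\<close>

definition unit_cube :: "(real ^ 'n) set" where
  "unit_cube = {u. \<forall>i. u $ i \<in> {-1/2..<1/2}}"

definition shifted_count :: "real ^ 'n ^ 'n \<Rightarrow> real \<Rightarrow> real ^ 'n \<Rightarrow> nat" where
  "shifted_count L R y = card {m. norm (L *v (y + int_vec m)) < R}"

lemma fejer_vec_nonneg: "0 \<le> fejer_vec M u"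
  by (simp add: fejer_vec_def prod_nonneg fejer_nonneg)

lemma borel_measurable_fejer_vec [measurable]: "fejer_vec M \<in> borel_measurable borel"
  unfolding fejer_vec_def by measurable

lemma fejer_vec_add_int: "fejer_vec M (u + int_vec m) = fejer_vec M u"
  by (simp add: fejer_vec_def fejer_add_int)

lemma sets_unit_cube [measurable]: "unit_cube \<in> sets borel"
  unfolding unit_cube_def by measurable

lemma indicator_unit_cube: "indicator unit_cube u = (\<Prod>i\<in>UNIV. indicator {-1/2..<1/2} (u $ i) :: real)"
proof (cases "u \<in> unit_cube")
  case True
  then have "u $ i \<in> {-1/2..<1/2}" for i
    by (simp add: unit_cube_def)
  with True show ?thesis
    by simp
next
  case False
  then obtain i where "u $ i \<notin> {-1/2..<1/2}"
    unfolding unit_cube_def by blast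
  then have "(\<Prod>i\<in>UNIV. indicator {-1/2..<1/2} (u $ i) :: real) = 0"
    by (intro prod_zero bexI[of _ i]) simp_all
  with False show ?thesis
    by simp
qed

section \<open>Mass and tails of the product kernel\<close>

lemma nn_integral_lborel_prod_vec:
  fixes g :: "'n::finite \<Rightarrow> real \<Rightarrow> real"
  assumes [measurable]: "\<And>i. g i \<in> borel_measurable borel" and nn: "\<And>i t. 0 \<le> g i t"
  shows "(\<integral>\<^sup>+(x::real ^ 'n). ennreal (\<Prod>i\<in>UNIV. g i (x $ i)) \<partial>lborel) = (\<Prod>i\<in>UNIV. \<integral>\<^sup>+t. ennreal (g i t) \<partial>lborel)"
proof -
  define h where "h b = g (SOME i. b = axis i 1)" for b :: "real ^ 'n"
  have h: "h (axis i 1) = g i" for i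
    unfolding h_def by (rule arg_cong[of _ _ g]) (auto simp: axis_eq_axis)
  have "(\<integral>\<^sup>+(x::real ^ 'n). (\<Prod>b\<in>Basis. ennreal (h b (x \<bullet> b))) \<partial>lborel) = (\<Prod>b\<in>Basis. \<integral>\<^sup>+t. ennreal (h b t) \<partial>lborel)"
    by (rule nn_integral_lborel_prod) (auto simp: Basis_real_vec h)
  then show ?thesis
    unfolding Basis_real_vec prod.reindex[OF inj_axis_1]
    by (simp add: h inner_axis prod_ennreal nn)
qed

lemma nn_integral_fejer_vec:
  assumes "M > 0"
  shows "(\<integral>\<^sup>+(u::real ^ 'n). ennreal (indicator unit_cube u * fejer_vec M u) \<partial>lborel) = 1"
proof -
  have "(\<integral>\<^sup>+(u::real ^ 'n). ennreal (indicator unit_cube u * fejer_vec M u) \<partial>lborel) =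
      (\<integral>\<^sup>+(u::real ^ 'n). ennreal (\<Prod>i\<in>UNIV. indicator {-1/2..<1/2} (u $ i) * fejer M (u $ i)) \<partial>lborel)"
    by (simp only: indicator_unit_cube fejer_vec_def prod.distrib)
  also have "\<dots> = (\<Prod>i\<in>(UNIV :: 'n set). \<integral>\<^sup>+t. ennreal (indicator {-1/2..<1/2} t * fejer M t) \<partial>lborel)"
    by (rule nn_integral_lborel_prod_vec) (auto simp: fejer_nonneg)
  finally show ?thesis
    by (simp only: nn_integral_fejer[OF assms]) simp
qed

text \<open>A union bound over the coordinates: with one coordinate forced to be large, the other
  factors of the product integrate to 1.\<close>

lemma nn_integral_fejer_vec_tail:
  assumes "M > 0" "c > 0"
  shows "(\<integral>\<^sup>+(u::real ^ 'n). ennreal (indicator unit_cube u * indicator {u. \<exists>i. c < \<bar>u $ i\<bar>} u * fejer_vec M u) \<partial>lborel)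
    \<le> ennreal (real CARD('n) / (2 * real M * c))"
proof -
  let ?t = "\<lambda>k. \<integral>\<^sup>+(u::real ^ 'n). ennreal (indicator unit_cube u * indicator {t. c < \<bar>t\<bar>} (u $ k) * fejer_vec M u) \<partial>lborel"
  have t: "?t k \<le> ennreal (1 / (2 * real M * c))" for k
  proof -
    define g where "g i t = (if i = k then indicator {-1/2..<1/2} t * indicator {t. c < \<bar>t\<bar>} t * fejer M t
        else indicator {-1/2..<1/2} t * fejer M t)" for i :: 'n and t :: real
    have [measurable]: "g i \<in> borel_measurable borel" for i
      unfolding g_def by (cases "i = k") (simp_all, measurable)
    have "indicator unit_cube u * indicator {t. c < \<bar>t\<bar>} (u $ k) * fejer_vec M u = (\<Prod>i\<in>UNIV. g i (u $ i))" for u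
    proof -
      have "(\<Prod>i\<in>UNIV. g i (u $ i)) = (\<Prod>i\<in>UNIV. (indicator {-1/2..<1/2} (u $ i) * fejer M (u $ i)) *
          (if i = k then indicator {t. c < \<bar>t\<bar>} (u $ i) else 1))"
        by (intro prod.cong) (auto simp: g_def)
      also have "\<dots> = indicator unit_cube u * fejer_vec M u * indicator {t. c < \<bar>t\<bar>} (u $ k)"
        unfolding prod.distrib by (simp add: indicator_unit_cube fejer_vec_def)
      finally show ?thesis
        by simp
    qed
    then have "?t k = (\<integral>\<^sup>+(u::real ^ 'n). ennreal (\<Prod>i\<in>UNIV. g i (u $ i)) \<partial>lborel)"
      by simp
    also have "\<dots> = (\<Prod>i\<in>UNIV. \<integral>\<^sup>+t. ennreal (g i t) \<partial>lborel)"
      by (rule nn_integral_lborel_prod_vec) (auto simp: g_def fejer_nonneg)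
    also have "\<dots> = (\<Prod>i\<in>UNIV. if i = k then \<integral>\<^sup>+t. ennreal (g k t) \<partial>lborel else 1)"
      using nn_integral_fejer[OF assms(1)] by (intro prod.cong) (auto simp: g_def)
    also have "\<dots> = (\<integral>\<^sup>+t. ennreal (g k t) \<partial>lborel)"
      by simp
    also have "\<dots> \<le> ennreal (1 / (2 * real M * c))"
      using nn_integral_fejer_tail[OF assms] by (simp add: g_def)
    finally show ?thesis .
  qed
  have "(\<integral>\<^sup>+(u::real ^ 'n). ennreal (indicator unit_cube u * indicator {u. \<exists>i. c < \<bar>u $ i\<bar>} u * fejer_vec M u) \<partial>lborel) \<le>
      (\<integral>\<^sup>+(u::real ^ 'n). (\<Sum>k\<in>UNIV. ennreal (indicator unit_cube u * indicator {t. c < \<bar>t\<bar>} (u $ k) * fejer_vec M u)) \<partial>lborel)"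
  proof (rule nn_integral_mono)
    fix u :: "real ^ 'n"
    have "indicator {u. \<exists>i. c < \<bar>u $ i\<bar>} u \<le> (\<Sum>k\<in>UNIV. indicator {t. c < \<bar>t\<bar>} (u $ k) :: real)"
    proof (cases "\<exists>i. c < \<bar>u $ i\<bar>")
      case True
      then obtain i where "c < \<bar>u $ i\<bar>" by blast
      then show ?thesis
        using member_le_sum[of i UNIV "\<lambda>k. indicator {t. c < \<bar>t\<bar>} (u $ k) :: real"] by (auto simp: indicator_def)
    qed (auto simp: sum_nonneg)
    then have "indicator unit_cube u * fejer_vec M u * indicator {u. \<exists>i. c < \<bar>u $ i\<bar>} u \<le>
        indicator unit_cube u * fejer_vec M u * (\<Sum>k\<in>UNIV. indicator {t. c < \<bar>t\<bar>} (u $ k))"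
      by (intro mult_left_mono) (auto simp: fejer_vec_nonneg)
    then show "ennreal (indicator unit_cube u * indicator {u. \<exists>i. c < \<bar>u $ i\<bar>} u * fejer_vec M u) \<le>
        (\<Sum>k\<in>UNIV. ennreal (indicator unit_cube u * indicator {t. c < \<bar>t\<bar>} (u $ k) * fejer_vec M u))"
      by (subst sum_ennreal) (auto simp: fejer_vec_nonneg sum_distrib_left mult_ac intro!: ennreal_leI)
  qed
  also have "\<dots> = (\<Sum>k\<in>UNIV. ?t k)"
    by (rule nn_integral_sum) auto
  also have "\<dots> \<le> (\<Sum>k\<in>(UNIV::'n set). ennreal (1 / (2 * real M * c)))"
    by (intro sum_mono t)
  also have "\<dots> = ennreal (real CARD('n) / (2 * real M * c))"
    using assms by (subst sum_ennreal) simp_all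
  finally show ?thesis .
qed

lemma fejer_vec_expand:
  "complex_of_real (fejer_vec M (u :: real ^ 'n)) =
    (\<Sum>g\<in>UNIV \<rightarrow>\<^sub>E {..<M} \<times> {..<M}. cis (2 * pi * (int_vec (\<lambda>i. int (fst (g i)) - int (snd (g i))) \<bullet> u))) / of_nat M ^ CARD('n)"
proof -
  have "complex_of_real (fejer_vec M u) = (\<Prod>i\<in>UNIV.
      (\<Sum>p\<in>{..<M} \<times> {..<M}. cis (2 * pi * (real (fst p) - real (snd p)) * u $ i)) / of_nat M)"
    by (simp add: fejer_vec_def fejer_expand case_prod_unfold)
  also have "\<dots> = (\<Prod>i\<in>UNIV. \<Sum>p\<in>{..<M} \<times> {..<M}. cis (2 * pi * (real (fst p) - real (snd p)) * u $ i)) / of_nat M ^ CARD('n)"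
    by (simp add: prod_dividef)
  also have "(\<Prod>i\<in>UNIV. \<Sum>p\<in>{..<M} \<times> {..<M}. cis (2 * pi * (real (fst p) - real (snd p)) * u $ i)) =
      (\<Sum>g\<in>UNIV \<rightarrow>\<^sub>E {..<M} \<times> {..<M}. \<Prod>i\<in>UNIV. cis (2 * pi * (real (fst (g i)) - real (snd (g i))) * u $ i))"
    by (rule prod_sum_PiE) auto
  also have "\<dots> = (\<Sum>g\<in>UNIV \<rightarrow>\<^sub>E {..<M} \<times> {..<M}. cis (2 * pi * (int_vec (\<lambda>i. int (fst (g i)) - int (snd (g i))) \<bullet> u)))"
    by (intro sum.cong refl) (simp add: cis_conv_exp exp_sum[symmetric] inner_vec_def sum_distrib_left sum_distrib_right mult_ac)
  finally show ?thesis .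
qed

text \<open>Integration over all of space allows two readings: expanding the kernel gives Fourier
  integrals of the ellipsoid, and folding modulo integer vectors gives an average of
  \<open>shifted_count\<close>.\<close>

definition smoothed_count :: "nat \<Rightarrow> real ^ 'n ^ 'n \<Rightarrow> real \<Rightarrow> real ^ 'n \<Rightarrow> real" where
  "smoothed_count M L R x = (\<integral>z. indicator {z. norm (L *v (x + z)) < R} z * fejer_vec M z \<partial>lborel)"

lemma smoothed_count_expand:
  fixes L :: "real ^ 'n ^ 'n"
  assumes L: "invertible L" and R: "R > 0"
  shows "complex_of_real (smoothed_count M L R x) =
    (\<Sum>g\<in>UNIV \<rightarrow>\<^sub>E {..<M} \<times> {..<M}. \<integral>z. indicator {z. norm (L *v (x + z)) < R} z *\<^sub>R
      cis (2 * pi * (int_vec (\<lambda>i. int (fst (g i)) - int (snd (g i))) \<bullet> z)) \<partial>lborel) / of_nat M ^ CARD('n)"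
proof -
  let ?S = "{z. norm (L *v (x + z)) < R}"
  let ?c = "\<lambda>g z. cis (2 * pi * (int_vec (\<lambda>i. int (fst (g i)) - int (snd (g i))) \<bullet> z)) :: complex"
  have fin: "emeasure lborel ?S < \<infinity>"
    by (simp add: emeasure_ellipsoid[OF assms])
  have int: "integrable lborel (\<lambda>z. indicator ?S z *\<^sub>R ?c g z)" for g :: "'n \<Rightarrow> nat \<times> nat"
  proof (rule Bochner_Integration.integrable_bound[OF integrable_real_indicator[OF _ fin]])
    show "(\<lambda>z. indicator ?S z *\<^sub>R ?c g z) \<in> borel_measurable lborel"
      unfolding cis_conv_exp by measurable
  qed simp_all
  have "complex_of_real (smoothed_count M L R x) = (\<integral>z. complex_of_real (indicator ?S z * fejer_vec M z) \<partial>lborel)"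
    unfolding smoothed_count_def by (rule integral_complex_of_real[symmetric])
  also have "\<dots> = (\<integral>z. (\<Sum>g\<in>UNIV \<rightarrow>\<^sub>E {..<M} \<times> {..<M}. indicator ?S z *\<^sub>R ?c g z) / of_nat M ^ CARD('n) \<partial>lborel)"
    by (simp add: fejer_vec_expand scaleR_conv_of_real sum_distrib_left)
  also have "\<dots> = (\<Sum>g\<in>UNIV \<rightarrow>\<^sub>E {..<M} \<times> {..<M}. \<integral>z. indicator ?S z *\<^sub>R ?c g z \<partial>lborel) / of_nat M ^ CARD('n)"
    by (subst integral_divide_zero, subst Bochner_Integration.integral_sum) (auto intro: int)
  finally show ?thesis .
qed

section \<open>Integer translates and finiteness of the counts\<close>

lemma mem_unit_cube_diff_iff:
  "z - int_vec m \<in> unit_cube \<longleftrightarrow> m = (\<lambda>i. \<lfloor>z $ i + 1 / 2\<rfloor>)"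
proof -
  have "-1/2 \<le> z $ i - of_int (m i) \<and> z $ i - of_int (m i) < 1/2 \<longleftrightarrow> \<lfloor>z $ i + 1 / 2\<rfloor> = m i" for i
    unfolding floor_eq_iff by auto
  then show ?thesis
    by (auto simp: unit_cube_def fun_eq_iff)
qed

lemma finite_card_int_near:
  fixes y :: "real ^ 'n"
  shows "finite {m. \<forall>i. \<bar>y $ i + of_int (m i)\<bar> \<le> K}"
    and "card {m. \<forall>i. \<bar>y $ i + of_int (m i)\<bar> \<le> K} \<le> nat \<lceil>2 * K + 1\<rceil> ^ CARD('n)"
proof -
  let ?I = "\<lambda>i. {\<lceil>- (y $ i) - K\<rceil>..\<lfloor>- (y $ i) + K\<rfloor>}"
  have sub: "{m. \<forall>i. \<bar>y $ i + of_int (m i)\<bar> \<le> K} \<subseteq> PiE UNIV ?I"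
    by (auto simp: le_floor_iff ceiling_le_iff abs_le_iff PiE_def extensional_def) (smt (verit))+
  have fin: "finite (PiE UNIV ?I)"
    by (intro finite_PiE) auto
  show "finite {m. \<forall>i. \<bar>y $ i + of_int (m i)\<bar> \<le> K}"
    using finite_subset[OF sub fin] .
  have "card {m. \<forall>i. \<bar>y $ i + of_int (m i)\<bar> \<le> K} \<le> card (PiE UNIV ?I)"
    by (rule card_mono[OF fin sub])
  also have "\<dots> = (\<Prod>i\<in>UNIV. card (?I i))"
    by (simp add: card_PiE)
  also have "\<dots> \<le> (\<Prod>i\<in>(UNIV::'n set). nat \<lceil>2 * K + 1\<rceil>)"
  proof (intro prod_mono conjI)
    fix i
    have "of_int (\<lfloor>- (y $ i) + K\<rfloor> - \<lceil>- (y $ i) - K\<rceil> + 1) \<le> 2 * K + 1"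
      by simp linarith
    then have "\<lfloor>- (y $ i) + K\<rfloor> - \<lceil>- (y $ i) - K\<rceil> + 1 \<le> \<lceil>2 * K + 1\<rceil>"
      using le_of_int_ceiling[of "2 * K + 1"] by linarith
    then show "card (?I i) \<le> nat \<lceil>2 * K + 1\<rceil>"
      by simp
  qed auto
  finally show "card {m. \<forall>i. \<bar>y $ i + of_int (m i)\<bar> \<le> K} \<le> nat \<lceil>2 * K + 1\<rceil> ^ CARD('n)"
    by simp
qed

text \<open>\<open>B\<close> depends on \<open>L\<close>, so it may serve for finiteness and
  boundedness only and must not enter the error estimates.\<close>

lemma component_le_norm_image:
  fixes L :: "real ^ 'n ^ 'n"
  assumes "invertible L"
  obtains B where "B > 0" "\<And>(z :: real ^ 'n) i. \<bar>z $ i\<bar> \<le> B * norm (L *v z)"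
proof -
  have "inj ((*v) L)"
    using assms by (metis inj_matrix_vector_mult)
  then obtain B where B: "B > 0" "\<And>z. B * norm z \<le> norm (L *v z)"
    using linear_inj_bounded_below_pos[of "(*v) L"] by auto
  show thesis
  proof (rule that[of "1 / B"])
    fix z :: "real ^ 'n" and i
    have "\<bar>z $ i\<bar> \<le> norm z"
      by (rule component_le_norm_cart)
    also have "\<dots> \<le> 1 / B * norm (L *v z)"
      using B by (simp add: field_simps)
    finally show "\<bar>z $ i\<bar> \<le> 1 / B * norm (L *v z)" .
  qed (use B in simp)
qed

text \<open>Uniformity in \<open>y\<close> makes the supremum of the errors over all shifts a finite
  number, without which it could not be absorbed.\<close>

lemma shifted_count_bounded:
  fixes L :: "real ^ 'n ^ 'n"
  assumes "invertible L"
  shows "finite {m. norm (L *v (y + int_vec m)) < R}"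
    and "\<exists>N. \<forall>y. shifted_count L R y \<le> N"
proof -
  obtain B where B: "B > 0" "\<And>z i. \<bar>z $ i\<bar> \<le> B * norm (L *v z)"
    using component_le_norm_image[OF assms] by blast
  have sub: "{m. norm (L *v (y + int_vec m)) < R} \<subseteq> {m. \<forall>i. \<bar>y $ i + of_int (m i)\<bar> \<le> B * R}" for y
  proof safe
    fix m i
    assume "norm (L *v (y + int_vec m)) < R"
    with B(1) have "B * norm (L *v (y + int_vec m)) \<le> B * R"
      by simp
    with B(2)[of "y + int_vec m" i] show "\<bar>y $ i + of_int (m i)\<bar> \<le> B * R"
      by simp
  qed
  show "finite {m. norm (L *v (y + int_vec m)) < R}"
    using finite_subset[OF sub finite_card_int_near(1)] .
  have "shifted_count L R y \<le> nat \<lceil>2 * (B * R) + 1\<rceil> ^ CARD('n)" for y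
    unfolding shifted_count_def
    using card_mono[OF finite_card_int_near(1) sub[of y]] finite_card_int_near(2)[of y "B * R"] by linarith
  then show "\<exists>N. \<forall>y. shifted_count L R y \<le> N"
    by blast
qed

lemma integrable_lborel_translate:
  fixes g :: "'a::euclidean_space \<Rightarrow> real"
  assumes "integrable lborel g"
  shows "integrable lborel (\<lambda>z. g (t + z))" "(\<integral>z. g (t + z) \<partial>lborel) = (\<integral>z. g z \<partial>lborel)"
proof -
  have [measurable]: "g \<in> borel_measurable borel"
    using borel_measurable_integrable[OF assms] by simp
  have "integrable (distr lborel borel ((+) t)) g"
    using assms by (simp add: lborel_distr_plus)
  then show "integrable lborel (\<lambda>z. g (t + z))"
    by (subst (asm) integrable_distr_eq) auto
  have "(\<integral>z. g z \<partial>lborel) = (\<integral>z. g z \<partial>distr lborel borel ((+) t))"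
    by (simp add: lborel_distr_plus)
  also have "\<dots> = (\<integral>z. g (t + z) \<partial>lborel)"
    by (rule integral_distr) auto
  finally show "(\<integral>z. g (t + z) \<partial>lborel) = (\<integral>z. g z \<partial>lborel)" ..
qed

lemma integrable_fejer_vec:
  assumes "M > 0"
  shows "integrable lborel (\<lambda>u :: real ^ 'n. indicator unit_cube u * fejer_vec M u)"
    and "(\<integral>(u :: real ^ 'n). indicator unit_cube u * fejer_vec M u \<partial>lborel) = 1"
proof -
  have nn: "0 \<le> indicator unit_cube u * fejer_vec M u" for u :: "real ^ 'n"
    by (simp add: fejer_vec_nonneg)
  show "integrable lborel (\<lambda>u :: real ^ 'n. indicator unit_cube u * fejer_vec M u)"
    by (rule integrableI_nonneg) (use nn nn_integral_fejer_vec[OF assms, where 'n = 'n] in auto)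
  show "(\<integral>(u :: real ^ 'n). indicator unit_cube u * fejer_vec M u \<partial>lborel) = 1"
    by (subst integral_eq_nn_integral) (use nn nn_integral_fejer_vec[OF assms, where 'n = 'n] in auto)
qed

text \<open>Unfolding the integral over space to the torus turns the convolution of the ball with the
  periodic kernel into an average of the shifted lattice point counts.\<close>
lemma smoothed_count_unfold:
  fixes L :: "real ^ 'n ^ 'n"
  assumes L: "invertible L" and M: "M > 0"
  shows "integrable lborel (\<lambda>u. indicator unit_cube u * fejer_vec M u * real (shifted_count L R (x + u)))"
    and "smoothed_count M L R x =
      (\<integral>u. indicator unit_cube u * fejer_vec M u * real (shifted_count L R (x + u)) \<partial>lborel)"
proof -
  let ?S = "{z. norm (L *v (x + z)) < R}"
  obtain B where B: "B > 0" "\<And>z i. \<bar>z $ i\<bar> \<le> B * norm (L *v z)"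
    using component_le_norm_image[OF L] by blast
  \<comment> \<open>One finite set of translates that works for all \<open>u\<close> in the cube
    simultaneously, so that sum and integral can be exchanged.\<close>
  define F where "F = {m. \<exists>u\<in>unit_cube. norm (L *v (x + (u + int_vec m))) < R}"
  have "F \<subseteq> {m. \<forall>i. \<bar>x $ i + of_int (m i)\<bar> \<le> B * R + 1}"
    unfolding F_def
  proof safe
    fix m i and u :: "real ^ 'n"
    assume *: "u \<in> unit_cube" "norm (L *v (x + (u + int_vec m))) < R"
    have "\<bar>u $ i\<bar> \<le> 1 / 2"
    proof -
      have "-1/2 \<le> u $ i \<and> u $ i < 1/2"
        using *(1) by (simp add: unit_cube_def)
      then show ?thesis by linarith
    qed
    moreover have "B * norm (L *v (x + (u + int_vec m))) \<le> B * R"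
      using * B(1) by simp
    ultimately show "\<bar>x $ i + of_int (m i)\<bar> \<le> B * R + 1"
      using B(2)[of "x + (u + int_vec m)" i] by simp
  qed
  then have fin: "finite F"
    using finite_card_int_near(1) finite_subset by blast
  define g where "g m u = indicator ?S (u + int_vec m) * (indicator unit_cube u * fejer_vec M u)" for m u
  have [measurable]: "?S \<in> sets borel"
    by measurable
  have [measurable]: "g m \<in> borel_measurable borel" for m
    unfolding g_def by measurable
  have int: "integrable lborel (g m)" for m
    by (rule Bochner_Integration.integrable_bound[OF integrable_fejer_vec(1)[OF M]])
       (auto simp: g_def indicator_def)
  have sum_g: "(\<Sum>m\<in>F. g m u) = indicator unit_cube u * fejer_vec M u * real (shifted_count L R (x + u))" for u
  proof (cases "u \<in> unit_cube")
    case True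
    have "{m. norm (L *v (x + u + int_vec m)) < R} = {m\<in>F. u + int_vec m \<in> ?S}"
      using True by (auto simp: F_def add.assoc)
    moreover have "real (card {m\<in>F. u + int_vec m \<in> ?S}) = (\<Sum>m\<in>F. indicator ?S (u + int_vec m))"
      using fin by (simp add: indicator_def sum.If_cases Int_def of_bool_def)
    ultimately show ?thesis
      using True by (simp add: g_def shifted_count_def sum_distrib_left mult.commute)
  qed (simp add: g_def)
  have "integrable lborel (\<lambda>u. \<Sum>m\<in>F. g m u)"
    by (intro Bochner_Integration.integrable_sum int)
  then show "integrable lborel (\<lambda>u. indicator unit_cube u * fejer_vec M u * real (shifted_count L R (x + u)))"
    unfolding sum_g .
  \<comment> \<open>Rounding the coordinates of \<open>z\<close> picks the only \<open>m\<close>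
    with \<open>z - int_vec m\<close> in the cube, and for \<open>z\<close> in the ellipsoid that
    \<open>m\<close> belongs to \<open>F\<close>.\<close>
  have "indicator ?S z * fejer_vec M z = (\<Sum>m\<in>F. g m (- int_vec m + z))" for z
  proof -
    have "(\<Sum>m\<in>F. g m (- int_vec m + z)) =
        (\<Sum>m\<in>F. indicator ?S z * fejer_vec M z * (if m = (\<lambda>i. \<lfloor>z $ i + 1 / 2\<rfloor>) then 1 else 0))"
    proof (intro sum.cong refl)
      fix m
      have "fejer_vec M (- int_vec m + z) = fejer_vec M z"
        using fejer_vec_add_int[of M "- int_vec m + z" m] by simp
      then show "g m (- int_vec m + z) = indicator ?S z * fejer_vec M z * (if m = (\<lambda>i. \<lfloor>z $ i + 1 / 2\<rfloor>) then 1 else 0)"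
        using mem_unit_cube_diff_iff[of z m] by (simp add: g_def indicator_def)
    qed
    also have "\<dots> = (if (\<lambda>i. \<lfloor>z $ i + 1 / 2\<rfloor>) \<in> F then indicator ?S z * fejer_vec M z else 0)"
      using fin by (simp flip: sum_distrib_left)
    also have "\<dots> = indicator ?S z * fejer_vec M z"
    proof (cases "z \<in> ?S")
      case True
      define m where "m = (\<lambda>i. \<lfloor>z $ i + 1 / 2\<rfloor>)"
      have "z - int_vec m \<in> unit_cube"
        using mem_unit_cube_diff_iff m_def by blast
      moreover have "norm (L *v (x + ((z - int_vec m) + int_vec m))) < R"
        using True by simp
      ultimately have "m \<in> F"
        unfolding F_def by blast
      then show ?thesis
        by (simp add: m_def)
    qed simp
    finally show ?thesis ..
  qed
  then have "smoothed_count M L R x = (\<integral>z. (\<Sum>m\<in>F. g m (- int_vec m + z)) \<partial>lborel)"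
    by (simp add: smoothed_count_def)
  also have "\<dots> = (\<Sum>m\<in>F. \<integral>z. g m (- int_vec m + z) \<partial>lborel)"
    by (intro Bochner_Integration.integral_sum integrable_lborel_translate int)
  also have "\<dots> = (\<Sum>m\<in>F. \<integral>u. g m u \<partial>lborel)"
    by (intro sum.cong refl integrable_lborel_translate int)
  also have "\<dots> = (\<integral>u. (\<Sum>m\<in>F. g m u) \<partial>lborel)"
    by (intro Bochner_Integration.integral_sum[symmetric] int)
  finally show "smoothed_count M L R x =
      (\<integral>u. indicator unit_cube u * fejer_vec M u * real (shifted_count L R (x + u)) \<partial>lborel)"
    unfolding sum_g .
qed

section \<open>Comparison of the counts with their averages\<close>

lemma shifted_count_mono:
  fixes L :: "real ^ 'n ^ 'n"
  assumes "invertible L" "norm (L *v u) \<le> S - R"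
  shows "shifted_count L R x \<le> shifted_count L S (x + u)"
  unfolding shifted_count_def
proof (rule card_mono[OF shifted_count_bounded(1)[OF assms(1)]], safe)
  fix m
  assume "norm (L *v (x + int_vec m)) < R"
  moreover have "L *v (x + u + int_vec m) = L *v (x + int_vec m) + L *v u"
    by (simp add: matrix_vector_right_distrib)
  ultimately show "norm (L *v (x + u + int_vec m)) < S"
    using assms(2) norm_triangle_ineq[of "L *v (x + int_vec m)" "L *v u"] by simp
qed

text \<open>The kernel keeps three quarters of its mass near the origin; there the shifted counts are
  compared with the count at \<open>x\<close>, elsewhere only with the supremum \<open>E\<close> of all errors, which can then
  be absorbed.\<close>
lemma discrepancy_le_smoothed:
  fixes L :: "real ^ 'n ^ 'n" and V :: "real \<Rightarrow> real"
  assumes L: "invertible L" and col: "\<And>i. norm (column i L) \<le> r" and M: "M > 0"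
    and delta: "\<delta> = 2 * (real CARD('n))\<^sup>2 * r / real M"
    and V: "V (R + \<delta>) - V R \<le> W" "V R - V (R - \<delta>) \<le> W"
    and T: "\<And>x. \<bar>smoothed_count M L (R + \<delta>) x - V (R + \<delta>)\<bar> \<le> T"
      "\<And>x. \<bar>smoothed_count M L (R - \<delta>) x - V (R - \<delta>)\<bar> \<le> T"
  shows "\<bar>real (shifted_count L R x) - V R\<bar> \<le> 2 * (W + T)"
proof -
  define f where "f x = real (shifted_count L R x)" for x
  define E where "E = (SUP x. \<bar>f x - V R\<bar>)"
  obtain N where N: "\<And>y. shifted_count L R y \<le> N"
    using shifted_count_bounded(2)[OF L] by blast
  have bdd: "bdd_above (range (\<lambda>x. \<bar>f x - V R\<bar>))"
  proof (rule bdd_aboveI2)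
    fix x
    have "f x \<le> real N" "0 \<le> f x"
      using N[of x] by (auto simp: f_def)
    then show "\<bar>f x - V R\<bar> \<le> real N + \<bar>V R\<bar>"
      by linarith
  qed
  have E: "\<bar>f x - V R\<bar> \<le> E" for x
    unfolding E_def by (rule cSUP_upper[OF _ bdd]) simp
  \<comment> \<open>Makes the tail bound \<open>d / (2 * M * c)\<close> equal to 1/4; then
    \<open>\<delta> = d * c * r\<close> is the largest displacement \<open>norm (L *v u)\<close>
    that the near part can cause.\<close>
  define c where "c = 2 * real CARD('n) / real M"
  have c: "c > 0"
    using M by (simp add: c_def)
  define far where "far = {u :: real ^ 'n. \<exists>i. c < \<bar>u $ i\<bar>}"
  have [measurable]: "far \<in> sets borel"
    unfolding far_def by measurable
  define k where "k u = indicator unit_cube u * fejer_vec M u" for u :: "real ^ 'n"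
  have k0: "0 \<le> k u" for u
    by (simp add: k_def fejer_vec_nonneg)
  have k_int: "integrable lborel k" and k1: "(\<integral>u. k u \<partial>lborel) = 1"
    using integrable_fejer_vec[OF M, where 'n = 'n] by (simp_all add: k_def[abs_def])
  have [measurable]: "k \<in> borel_measurable borel"
    unfolding k_def by measurable
  have kf_int: "integrable lborel (\<lambda>u. indicator far u * k u)"
    by (rule Bochner_Integration.integrable_bound[OF k_int]) (auto simp: indicator_def)
  define p where "p = (\<integral>u. indicator far u * k u \<partial>lborel)"
  have p0: "0 \<le> p"
    unfolding p_def using k0 by (intro Bochner_Integration.integral_nonneg) auto
  have "ennreal p = (\<integral>\<^sup>+u. ennreal (indicator far u * k u) \<partial>lborel)"
    unfolding p_def using k0 kf_int by (subst nn_integral_eq_integral) auto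
  also have "\<dots> \<le> ennreal (real CARD('n) / (2 * real M * c))"
    using nn_integral_fejer_vec_tail[OF M c, where 'n = 'n] by (simp add: far_def k_def mult_ac)
  also have "real CARD('n) / (2 * real M * c) = 1 / 4"
    using M by (simp add: c_def)
  finally have p4: "p \<le> 1 / 4"
    by (subst (asm) ennreal_le_iff) auto
  have near: "norm (L *v u) \<le> \<delta>" if "u \<notin> far" for u
  proof -
    have u: "\<bar>u $ i\<bar> \<le> c" for i
      using that by (auto simp: far_def not_less)
    have "norm (L *v u) \<le> (\<Sum>i\<in>UNIV. norm (u $ i *\<^sub>R column i L))"
      unfolding matrix_vector_mult_columns_scaleR by (rule norm_sum)
    also have "\<dots> \<le> (\<Sum>i\<in>(UNIV :: 'n set). c * r)"
      using u col c by (intro sum_mono) (auto intro!: mult_mono)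
    also have "\<dots> = \<delta>"
      by (simp add: delta c_def power2_eq_square)
    finally show ?thesis .
  qed
  have bound: "3 / 4 * \<bar>f x - V R\<bar> \<le> W + T + E / 4" for x
  proof -
    \<comment> \<open>With \<open>s = -1\<close> a lower bound for the count at radius
      \<open>R + \<delta>\<close>, with \<open>s = 1\<close> an upper bound at
      \<open>R - \<delta>\<close>: near the origin by monotonicity in the radius, far away by the
      definition of \<open>E\<close>.\<close>
    let ?h = "\<lambda>s u. (1 - indicator far u) * f x + indicator far u * (V R + s * E)"
    have h_int: "integrable lborel (\<lambda>u. k u * ?h s u)"
      and h: "(\<integral>u. k u * ?h s u \<partial>lborel) = (1 - p) * f x + p * (V R + s * E)" for s
    proof -
      have eq: "k u * ?h s u = (k u - indicator far u * k u) * f x + indicator far u * k u * (V R + s * E)" for u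
        by (simp add: algebra_simps)
      show "integrable lborel (\<lambda>u. k u * ?h s u)"
        unfolding eq using k_int kf_int by auto
      show "(\<integral>u. k u * ?h s u \<partial>lborel) = (1 - p) * f x + p * (V R + s * E)"
        unfolding eq using k_int kf_int by (simp add: k1 p_def)
    qed
    have "(1 - p) * f x + p * (V R + (-1) * E) \<le> smoothed_count M L (R + \<delta>) x"
      unfolding smoothed_count_unfold(2)[OF L M] h[symmetric] k_def[symmetric]
    proof (rule integral_mono)
      show "integrable lborel (\<lambda>u. k u * real (shifted_count L (R + \<delta>) (x + u)))"
        using smoothed_count_unfold(1)[OF L M] by (simp add: k_def)
      fix u
      have "0 \<le> \<delta>"
        using near[of 0] c by (simp add: far_def)
      have "?h (-1) u \<le> real (shifted_count L (R + \<delta>) (x + u))"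
      proof (cases "u \<in> far")
        case True
        have "V R - E \<le> f (x + u)"
          using E[of "x + u"] by linarith
        also have "\<dots> \<le> real (shifted_count L (R + \<delta>) (x + u))"
          using shifted_count_mono[OF L, of 0 "R + \<delta>" R "x + u"] \<open>0 \<le> \<delta>\<close> by (simp add: f_def)
        finally show ?thesis
          using True by simp
      next
        case False
        then show ?thesis
          using shifted_count_mono[OF L, of u "R + \<delta>" R x] near by (simp add: f_def)
      qed
      then show "k u * ?h (-1) u \<le> k u * real (shifted_count L (R + \<delta>) (x + u))"
        using k0 by (rule mult_left_mono)
    qed (rule h_int)
    moreover have "smoothed_count M L (R - \<delta>) x \<le> (1 - p) * f x + p * (V R + 1 * E)"
      unfolding smoothed_count_unfold(2)[OF L M] h[symmetric] k_def[symmetric]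
    proof (rule integral_mono)
      show "integrable lborel (\<lambda>u. k u * real (shifted_count L (R - \<delta>) (x + u)))"
        using smoothed_count_unfold(1)[OF L M] by (simp add: k_def)
      fix u
      have "0 \<le> \<delta>"
        using near[of 0] c by (simp add: far_def)
      have "real (shifted_count L (R - \<delta>) (x + u)) \<le> ?h 1 u"
      proof (cases "u \<in> far")
        case True
        have "real (shifted_count L (R - \<delta>) (x + u)) \<le> f (x + u)"
          using shifted_count_mono[OF L, of 0 R "R - \<delta>" "x + u"] \<open>0 \<le> \<delta>\<close> by (simp add: f_def)
        also have "\<dots> \<le> V R + E"
          using E[of "x + u"] by linarith
        finally show ?thesis
          using True by simp
      next
        case False
        have "norm (L *v (- u)) \<le> \<delta>"
          using near[OF False] by (simp add: linear_neg)
        with False show ?thesis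
          using shifted_count_mono[OF L, of "- u" R "R - \<delta>" "x + u"] by (simp add: f_def)
      qed
      then show "k u * real (shifted_count L (R - \<delta>) (x + u)) \<le> k u * ?h 1 u"
        using k0 by (rule mult_left_mono)
    qed (rule h_int)
    ultimately have "(1 - p) * (f x - V R) \<le> W + T + p * E" "(1 - p) * (V R - f x) \<le> W + T + p * E"
      using T[of x] V by (simp_all add: algebra_simps)
    then have "(1 - p) * \<bar>f x - V R\<bar> \<le> W + T + p * E"
      by (simp add: abs_if algebra_simps)
    moreover have "3 / 4 * \<bar>f x - V R\<bar> \<le> (1 - p) * \<bar>f x - V R\<bar>"
      using p4 by (intro mult_right_mono) auto
    moreover have "p * E \<le> 1 / 4 * E"
      using p4 E[of x] by (intro mult_right_mono) auto
    ultimately show ?thesis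
      by linarith
  qed
  have "\<bar>f x - V R\<bar> \<le> 4 / 3 * (W + T + E / 4)" for x
    using bound[of x] by (simp add: field_simps)
  \<comment> \<open>The supremum on both sides gives \<open>E \<le> 4 / 3 * (W + T) + E / 3\<close>,
    and solving for the finite number \<open>E\<close> produces the factor 2.\<close>
  then have "(SUP x. \<bar>f x - V R\<bar>) \<le> 4 / 3 * (W + T + E / 4)"
    by (intro cSUP_least) auto
  then have "E \<le> 4 / 3 * (W + T + E / 4)"
    unfolding E_def[symmetric] .
  then show ?thesis
    using E[of x] by (simp add: f_def)
qed

section \<open>The error term\<close>

text \<open>
  Bounding \<open>max |n\<^sub>i|\<close> from below by the geometric mean of the \<open>max 1 |n\<^sub>i|\<close> makes the sum over the
  frequencies a product of one-dimensional sums. For \<open>d = 1\<close> the exponent \<open>(d + 1) / (2 d)\<close> would give a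
  logarithm of \<open>M\<close>; any smaller one will do, because \<open>M\<close> is bounded in that case.
\<close>
lemma smoothed_count_error:
  defines "\<gamma> d \<equiv> if d = 1 then 1 / 2 else (d + 1) / (2 * d)"
  shows "\<exists>C\<ge>0. \<forall>(L :: real ^ 'n ^ 'n) r R M x.
     invertible L \<longrightarrow> (\<forall>i. norm (column i L) \<le> r) \<longrightarrow> 0 < r \<longrightarrow> 0 < R \<longrightarrow> 0 < M \<longrightarrow>
     \<bar>smoothed_count M L R x - unit_ball_vol (real CARD('n)) * R ^ CARD('n) / \<bar>det L\<bar>\<bar> \<le>
       C / \<bar>det L\<bar> * R powr ((real CARD('n) - 1) / 2) * r powr ((real CARD('n) + 1) / 2) *
       real M powr ((1 - \<gamma> (real CARD('n))) * real CARD('n))"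
proof -
  let ?d = "real CARD('n)"
  let ?e = "(?d + 1) / 2"
  have d1: "1 \<le> ?d"
    by (simp add: Suc_leI)
  have d2: "2 \<le> ?d" if "?d \<noteq> 1"
  proof -
    have "CARD('n) \<noteq> 0" "CARD('n) \<noteq> 1"
      using that by auto
    then show ?thesis by linarith
  qed
  define g where "g = \<gamma> ?d"
  \<comment> \<open>The first two facts keep the one-dimensional sums at order
    \<open>M powr (1 - g)\<close>; the third lets \<open>d\<close> factors with exponent
    \<open>g\<close> together stay within the decay exponent \<open>?e\<close>.\<close>
  have g: "0 < g" "g < 1" "g * ?d \<le> ?e"
    by (cases "?d = 1"; use d2 in \<open>simp add: g_def \<gamma>_def field_simps\<close>)+
  obtain C where C: "C \<ge> 0" "\<And>(L :: real ^ 'n ^ 'n) m x r R i.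
     invertible L \<Longrightarrow> R > 0 \<Longrightarrow> r > 0 \<Longrightarrow> norm (column i L) \<le> r \<Longrightarrow> m i \<noteq> 0 \<Longrightarrow>
     cmod (\<integral>z. indicator {z. norm (L *v (x + z)) < R} z *\<^sub>R cis (2 * pi * (int_vec m \<bullet> z)) \<partial>lborel)
       \<le> C / \<bar>det L\<bar> * R powr ((?d - 1) / 2) * r powr ?e * \<bar>of_int (m i)\<bar> powr (- ?e)"
    using fourier_ellipsoid_bound[where 'n = 'n] by blast
  define C' where "C' = C * (1 + 2 / (1 - g)) ^ CARD('n)"
  show ?thesis
  proof (intro exI[of _ C'] conjI allI impI)
    show "0 \<le> C'"
      using C(1) g by (simp add: C'_def)
    fix L :: "real ^ 'n ^ 'n" and r R :: real and M :: nat and x :: "real ^ 'n"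
    assume L: "invertible L" and col: "\<forall>i. norm (column i L) \<le> r" and r: "0 < r" and R: "0 < R" and M: "0 < M"
    define V where "V = unit_ball_vol ?d * R ^ CARD('n) / \<bar>det L\<bar>"
    define K where "K = C / \<bar>det L\<bar> * R powr ((?d - 1) / 2) * r powr ?e"
    have K: "0 \<le> K"
      using C(1) by (simp add: K_def)
    let ?S = "{z. norm (L *v (x + z)) < R}"
    let ?G = "PiE (UNIV :: 'n set) (\<lambda>_. {..<M} \<times> {..<M})"
    define m where "m p i = int (fst (p i)) - int (snd (p i))" for p :: "'n \<Rightarrow> nat \<times> nat" and i
    define I where "I p = (\<integral>z. indicator ?S z *\<^sub>R cis (2 * pi * (int_vec (m p) \<bullet> z)) \<partial>lborel)" for p
    \<comment> \<open>It is 1 exactly at the zero frequency, which \<open>M ^ d\<close> of the index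
      families represent; after normalisation the total of \<open>V * diag p\<close> is therefore
      the volume term \<open>V\<close>.\<close>
    define diag where "diag p = (\<Prod>i\<in>UNIV. if fst (p i) = snd (p i) then 1 else 0 :: real)" for p :: "'n \<Rightarrow> nat \<times> nat"
    define w where "w p = (\<Prod>i\<in>UNIV. max 1 \<bar>real (fst (p i)) - real (snd (p i))\<bar> powr (- g))" for p :: "'n \<Rightarrow> nat \<times> nat"
    have I_bound: "cmod (I p - of_real (V * diag p)) \<le> K * w p" for p
    proof (cases "\<forall>i. fst (p i) = snd (p i)")
      case True
      then have "m p = (\<lambda>_. 0)"
        by (simp add: m_def fun_eq_iff)
      then have "int_vec (m p) = 0"
        by (simp add: vec_eq_iff)
      then have "I p = (\<integral>z. of_real (indicator ?S z) \<partial>lborel)"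
        unfolding I_def by (simp add: scaleR_conv_of_real)
      also have "\<dots> = of_real (\<integral>z. indicator ?S z \<partial>lborel)"
        by (rule integral_complex_of_real)
      also have "(\<integral>z. indicator ?S z \<partial>lborel) = V"
        using emeasure_ellipsoid[OF L R, of x] R
        by (simp add: measure_def V_def)
      finally have "I p = of_real (V * diag p)"
        using True by (simp add: diag_def)
      moreover have "0 \<le> K * w p"
        using K by (simp add: w_def prod_nonneg)
      ultimately show ?thesis
        by simp
    next
      case False
      then have diag: "diag p = 0"
        by (auto simp: diag_def prod_zero_iff)
      define \<mu> where "\<mu> = Max (range (\<lambda>i. \<bar>m p i\<bar>))"
      have "\<mu> \<in> range (\<lambda>i. \<bar>m p i\<bar>)"
        unfolding \<mu>_def by (intro Max_in) auto
      then obtain i where i: "\<mu> = \<bar>m p i\<bar>"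
        by blast
      have le: "\<bar>m p j\<bar> \<le> \<mu>" for j
        unfolding \<mu>_def by (intro Max_ge) auto
      obtain j where "fst (p j) \<noteq> snd (p j)"
        using False by blast
      then have "1 \<le> \<bar>m p j\<bar>"
        by (simp add: m_def)
      with le[of j] have mu1: "1 \<le> \<mu>"
        by linarith
      then have "m p i \<noteq> 0"
        using i by auto
      have "cmod (I p) \<le> K * \<bar>of_int (m p i)\<bar> powr (- ?e)"
        unfolding I_def K_def by (rule C(2)) (use L R r col \<open>m p i \<noteq> 0\<close> in auto)
      also have "\<bar>of_int (m p i)\<bar> powr (- ?e) = of_int \<mu> powr (- ?e)"
        by (simp add: i)
      also have "K * of_int \<mu> powr (- ?e) \<le> K * w p"
      proof (rule mult_left_mono[OF _ K])
        have "of_int \<mu> powr (- ?e) \<le> of_int \<mu> powr (- g * ?d)"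
          using mu1 g by (intro powr_mono) auto
        also have "\<dots> = (of_int \<mu> powr (- g)) powr ?d"
          by (simp add: powr_powr)
        also have "\<dots> = (\<Prod>i\<in>(UNIV :: 'n set). of_int \<mu> powr (- g))"
          using mu1 by (simp add: powr_realpow)
        also have "\<dots> \<le> w p"
          unfolding w_def
        proof (intro prod_mono conjI)
          fix j
          have "\<bar>real (fst (p j)) - real (snd (p j))\<bar> = real_of_int \<bar>m p j\<bar>"
            by (simp add: m_def)
          also have "\<dots> \<le> real_of_int \<mu>"
            using le[of j] by (simp only: of_int_le_iff)
          finally show "of_int \<mu> powr (- g) \<le> max 1 \<bar>real (fst (p j)) - real (snd (p j))\<bar> powr (- g)"
            using mu1 g by (intro powr_mono2') auto
        qed auto
        finally show "of_int \<mu> powr (- ?e) \<le> w p" .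
      qed
      finally show ?thesis
        by (simp add: diag)
    qed
    have sum_diag: "(\<Sum>p\<in>?G. diag p) = real M ^ CARD('n)"
    proof -
      have "(\<Sum>p\<in>?G. diag p) = (\<Prod>i\<in>(UNIV :: 'n set). \<Sum>q\<in>{..<M} \<times> {..<M}. if fst q = snd q then 1 else 0)"
        unfolding diag_def by (rule prod_sum_PiE[symmetric]) auto
      also have "(\<Sum>q\<in>{..<M} \<times> {..<M}. if fst q = snd q then 1 else 0 :: real) = real M"
        using sum.cartesian_product[of "\<lambda>j l. if j = l then 1 else 0 :: real" "{..<M}" "{..<M}", symmetric]
        by (simp add: case_prod_unfold)
      finally show ?thesis
        by simp
    qed
    have "complex_of_real (smoothed_count M L R x - V) = (\<Sum>p\<in>?G. I p - of_real (V * diag p)) / of_nat M ^ CARD('n)"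
    proof -
      have "complex_of_real (smoothed_count M L R x) = (\<Sum>p\<in>?G. I p) / of_nat M ^ CARD('n)"
        unfolding smoothed_count_expand[OF L R] I_def m_def ..
      moreover have "complex_of_real V = (\<Sum>p\<in>?G. of_real (V * diag p)) / of_nat M ^ CARD('n)"
        using M by (simp add: sum_diag flip: of_real_sum sum_distrib_left)
      ultimately show ?thesis
        by (simp add: sum_subtractf diff_divide_distrib)
    qed
    from arg_cong[OF this, of cmod]
    have "\<bar>smoothed_count M L R x - V\<bar> = cmod (\<Sum>p\<in>?G. I p - of_real (V * diag p)) / real M ^ CARD('n)"
      by (simp only: norm_of_real norm_divide norm_power norm_of_nat)
    also have "\<dots> \<le> (\<Sum>p\<in>?G. K * w p) / real M ^ CARD('n)"
      by (intro divide_right_mono sum_norm_le I_bound zero_le_power of_nat_0_le_iff)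
    also have "\<dots> = K * (\<Prod>i\<in>(UNIV :: 'n set). (\<Sum>(j, l)\<in>{..<M} \<times> {..<M}. max 1 \<bar>real j - real l\<bar> powr (- g)) / real M)"
      unfolding w_def sum_distrib_left[symmetric]
      by (subst prod_sum_PiE[symmetric]) (auto simp: case_prod_unfold power_divide)
    also have "\<dots> \<le> K * (\<Prod>i\<in>(UNIV :: 'n set). (1 + 2 / (1 - g)) * real M powr (1 - g))"
      using K sum_diff_powr_le[OF g(1,2) M]
      by (intro mult_left_mono prod_mono conjI divide_nonneg_nonneg sum_nonneg) auto
    also have "\<dots> = K * ((1 + 2 / (1 - g)) ^ CARD('n) * real M powr ((1 - g) * ?d))"
      using M by (simp add: power_mult_distrib powr_realpow[symmetric] powr_powr)
    also have "\<dots> = C' / \<bar>det L\<bar> * R powr ((?d - 1) / 2) * r powr ?e * real M powr ((1 - g) * ?d)"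
      by (simp add: K_def C'_def)
    finally show "\<bar>smoothed_count M L R x - unit_ball_vol ?d * R ^ CARD('n) / \<bar>det L\<bar>\<bar> \<le>
       C' / \<bar>det L\<bar> * R powr ((?d - 1) / 2) * r powr ?e * real M powr ((1 - \<gamma> ?d) * ?d)"
      by (simp add: V_def g_def)
  qed
qed

lemma power_diff_le:
  fixes a b :: real
  assumes "0 \<le> a" "a \<le> b"
  shows "b ^ n - a ^ n \<le> real n * (b - a) * b ^ (n - 1)"
proof (induction n)
  case (Suc n)
  have "b ^ Suc n - a ^ Suc n = b * (b ^ n - a ^ n) + (b - a) * a ^ n"
    by (simp add: algebra_simps)
  also have "\<dots> \<le> b * (real n * (b - a) * b ^ (n - 1)) + (b - a) * b ^ n"
    using Suc assms by (intro add_mono mult_left_mono power_mono) auto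
  also have "b * (real n * (b - a) * b ^ (n - 1)) = real n * (b - a) * b ^ n"
    by (cases n) auto
  finally show ?case
    by (simp add: algebra_simps)
qed simp

lemma matrix_lattice_count_error:
  "\<exists>C\<ge>0. \<forall>(L :: real ^ 'n ^ 'n) r R.
     invertible L \<longrightarrow> (\<forall>i. norm (column i L) \<le> r) \<longrightarrow> 0 < r \<longrightarrow> r < R \<longrightarrow>
     \<bar>real (shifted_count L R 0) - unit_ball_vol (real CARD('n)) * R ^ CARD('n) / \<bar>det L\<bar>\<bar> \<le>
       C * (1 / \<bar>det L\<bar> * r powr (2 * real CARD('n) / (real CARD('n) + 1)) *
       R powr (real CARD('n) * ((real CARD('n) - 1) / (real CARD('n) + 1))))"
proof -
  let ?d = "real CARD('n)"
  define g where "g = (if ?d = 1 then 1 / 2 else (?d + 1) / (2 * ?d))"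
  define v where "v = unit_ball_vol ?d"
  have v: "0 \<le> v"
    by (simp add: v_def)
  have d1: "1 \<le> ?d"
    by (simp add: Suc_leI)
  have d2: "2 \<le> ?d" if "?d \<noteq> 1"
  proof -
    have "CARD('n) \<noteq> 0" "CARD('n) \<noteq> 1"
      using that by auto
    then show ?thesis by linarith
  qed
  have g: "0 < g" "g < 1"
    by (cases "?d = 1"; use d2 in \<open>simp add: g_def field_simps\<close>)+
  define \<kappa> where "\<kappa> = (1 - g) * ?d"
  define \<beta> where "\<beta> = (?d - 1) / (?d + 1)"
  have \<kappa>: "0 \<le> \<kappa>" and \<beta>: "0 \<le> \<beta>"
    using g d1 by (auto simp: \<kappa>_def \<beta>_def)
  \<comment> \<open>For \<open>d > 1\<close> already \<open>\<kappa> = (d - 1) / 2\<close>. For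
    \<open>d = 1\<close> the exponent is \<open>1 / 2\<close> instead, but then
    \<open>\<beta> = 0\<close> and both products vanish.\<close>
  have \<beta>\<kappa>: "\<beta> * \<kappa> = \<beta> * ((?d - 1) / 2)"
    using d1 by (auto simp: \<beta>_def \<kappa>_def g_def field_simps)
  obtain C where C: "C \<ge> 0" "\<And>(L :: real ^ 'n ^ 'n) r R M x.
     invertible L \<Longrightarrow> (\<And>i. norm (column i L) \<le> r) \<Longrightarrow> 0 < r \<Longrightarrow> 0 < R \<Longrightarrow> 0 < M \<Longrightarrow>
     \<bar>smoothed_count M L R x - v * R ^ CARD('n) / \<bar>det L\<bar>\<bar> \<le>
       C / \<bar>det L\<bar> * R powr ((?d - 1) / 2) * r powr ((?d + 1) / 2) * real M powr \<kappa>"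
    using smoothed_count_error[where 'n = 'n] unfolding \<kappa>_def g_def v_def by blast
  \<comment> \<open>The factor makes \<open>\<delta> \<le> r / (2 * X) < R / 2\<close>, so that both
    radii \<open>R - \<delta>\<close> and \<open>R + \<delta>\<close> stay between 0 and
    \<open>2 * R\<close>.\<close>
  define A where "A = 4 * ?d\<^sup>2"
  have A: "4 \<le> A"
    using d1 by (simp add: A_def)
  define D where "D = v * ?d / 2 * 2 ^ (CARD('n) - 1)"
  define D' where "D' = C * 2 powr ((?d - 1) / 2) * (2 * A) powr \<kappa>"
  show ?thesis
  proof (intro exI[of _ "2 * (D + D')"] conjI allI impI)
    show "0 \<le> 2 * (D + D')"
      using C(1) v by (simp add: D_def D'_def)
    fix L :: "real ^ 'n ^ 'n" and r R :: real
    assume L: "invertible L" and col: "\<forall>i. norm (column i L) \<le> r" and r: "0 < r" and rR: "r < R"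
    define X where "X = (R / r) powr \<beta>"
    have X1: "1 \<le> X"
      unfolding X_def using r rR \<beta> by (intro ge_one_powr_ge_zero) auto
    have R: "0 < R"
      using r rR by simp
    \<comment> \<open>Because \<open>A * X \<ge> 4\<close>, rounding up at most doubles the value,
      so \<open>M\<close> is comparable to \<open>X\<close> from both sides.\<close>
    define M where "M = nat \<lceil>A * X\<rceil>"
    have AX: "4 \<le> A * X"
      using A X1 mult_mono[of 4 A 1 X] by simp
    have M: "A * X \<le> real M" "real M \<le> 2 * A * X"
      using AX by (auto simp: M_def of_nat_nat) linarith+
    then have M0: "0 < M"
      using AX by (metis less_le_trans of_nat_0_less_iff zero_less_numeral order_less_le_trans)
    define \<delta> where "\<delta> = 2 * ?d\<^sup>2 * r / real M"
    define rX where "rX = r / (2 * X)"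
    have \<delta>0: "0 \<le> \<delta>"
      using r by (simp add: \<delta>_def)
    have \<delta>X: "\<delta> \<le> rX"
    proof -
      have "\<delta> \<le> 2 * ?d\<^sup>2 * r / (A * X)"
        unfolding \<delta>_def using M AX r A X1 by (intro divide_left_mono mult_pos_pos) auto
      also have "\<dots> = rX"
        using d1 by (simp add: A_def rX_def field_simps)
      finally show ?thesis .
    qed
    have "rX \<le> r / 2"
      unfolding rX_def using r X1 by (intro divide_left_mono) auto
    with \<delta>X rR have \<delta>R: "\<delta> < R / 2"
      by linarith
    define V where "V \<rho> = v * \<rho> ^ CARD('n) / \<bar>det L\<bar>" for \<rho>
    define W where "W = v / \<bar>det L\<bar> * (?d * rX * (2 * R) ^ (CARD('n) - 1))"
    define T where "T = C / \<bar>det L\<bar> * (2 * R) powr ((?d - 1) / 2) * r powr ((?d + 1) / 2) * real M powr \<kappa>"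
    have Wb: "V b - V a \<le> W" if ab: "0 \<le> a" "a \<le> b" "b \<le> 2 * R" "b - a \<le> rX" for a b
    proof -
      have "V b - V a = v / \<bar>det L\<bar> * (b ^ CARD('n) - a ^ CARD('n))"
        by (simp add: V_def diff_divide_distrib right_diff_distrib)
      also have "b ^ CARD('n) - a ^ CARD('n) \<le> ?d * (b - a) * b ^ (CARD('n) - 1)"
        using ab by (intro power_diff_le) auto
      also have "\<dots> \<le> ?d * rX * (2 * R) ^ (CARD('n) - 1)"
        using ab by (intro mult_mono power_mono mult_left_mono) auto
      finally show ?thesis
        using v by (simp add: W_def mult_left_mono divide_right_mono)
    qed
    have Tb: "\<bar>smoothed_count M L \<rho> x - V \<rho>\<bar> \<le> T" if \<rho>: "0 < \<rho>" "\<rho> \<le> 2 * R" for \<rho> x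
    proof -
      have "\<bar>smoothed_count M L \<rho> x - V \<rho>\<bar> \<le>
          C / \<bar>det L\<bar> * \<rho> powr ((?d - 1) / 2) * r powr ((?d + 1) / 2) * real M powr \<kappa>"
        unfolding V_def using C(2) L col r \<rho>(1) M0 by blast
      also have "\<dots> \<le> T"
        unfolding T_def using C(1) \<rho> d1 by (intro mult_right_mono mult_left_mono powr_mono2) auto
      finally show ?thesis .
    qed
    have "\<bar>real (shifted_count L R 0) - V R\<bar> \<le> 2 * (W + T)"
    proof (rule discrepancy_le_smoothed[OF L _ M0 \<delta>_def])
      show "V (R + \<delta>) - V R \<le> W" "V R - V (R - \<delta>) \<le> W"
        using R \<delta>0 \<delta>R \<delta>X by (auto intro!: Wb)
      show "\<bar>smoothed_count M L (R + \<delta>) x - V (R + \<delta>)\<bar> \<le> T"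
        "\<bar>smoothed_count M L (R - \<delta>) x - V (R - \<delta>)\<bar> \<le> T" for x
        using R \<delta>0 \<delta>R by (auto intro!: Tb)
    qed (use col in blast)
    also have "\<dots> \<le> 2 * (D + D') * (1 / \<bar>det L\<bar> * r powr (2 * ?d / (?d + 1)) * R powr (?d * \<beta>))"
    proof -
      \<comment> \<open>The exponents meet here: \<open>1 + \<beta> = 2 * d / (d + 1)\<close> for
        \<open>r\<close> and \<open>d - 1 - \<beta> = d * \<beta>\<close> for \<open>R\<close>. The
        term \<open>T\<close> yields the same two by the choice of \<open>X\<close>.\<close>
      have Xi: "1 / X = r powr \<beta> * R powr (- \<beta>)"
        unfolding X_def using r R by (simp add: powr_divide powr_minus field_simps)
      have "W = v / \<bar>det L\<bar> * (?d * (r / 2 * (1 / X)) * (2 ^ (CARD('n) - 1) * R ^ (CARD('n) - 1)))"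
        by (simp add: W_def rX_def power_mult_distrib)
      also have "\<dots> = D * (1 / \<bar>det L\<bar> * (r * r powr \<beta>) * (R ^ (CARD('n) - 1) * R powr (- \<beta>)))"
        unfolding Xi by (simp add: D_def mult_ac)
      also have "r * r powr \<beta> = r powr (2 * ?d / (?d + 1))"
      proof -
        have "1 + \<beta> = 2 * ?d / (?d + 1)"
          using d1 by (simp add: \<beta>_def field_simps)
        then show ?thesis
          using r powr_add[of r 1 \<beta>] by simp
      qed
      also have "R ^ (CARD('n) - 1) * R powr (- \<beta>) = R powr (?d * \<beta>)"
      proof -
        have "R ^ (CARD('n) - 1) = R powr (?d - 1)"
          using R d1 powr_realpow[of R "CARD('n) - 1"] by (simp add: of_nat_diff)
        moreover have "?d - 1 + - \<beta> = ?d * \<beta>"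
          using d1 by (simp add: \<beta>_def field_simps)
        ultimately show ?thesis
          by (simp flip: powr_add)
      qed
      finally have W: "W = D * (1 / \<bar>det L\<bar> * r powr (2 * ?d / (?d + 1)) * R powr (?d * \<beta>))" .
      have "real M powr \<kappa> \<le> (2 * A * X) powr \<kappa>"
        using M \<kappa> by (intro powr_mono2) auto
      also have "\<dots> = (2 * A) powr \<kappa> * (R / r) powr (\<beta> * \<kappa>)"
        using A X1 by (simp add: powr_mult X_def powr_powr)
      also have "(R / r) powr (\<beta> * \<kappa>) = R powr (\<beta> * ((?d - 1) / 2)) * r powr (- (\<beta> * ((?d - 1) / 2)))"
        unfolding \<beta>\<kappa> using r R by (simp add: powr_divide powr_minus field_simps)
      finally have "T \<le> C / \<bar>det L\<bar> * (2 * R) powr ((?d - 1) / 2) * r powr ((?d + 1) / 2) *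
          ((2 * A) powr \<kappa> * (R powr (\<beta> * ((?d - 1) / 2)) * r powr (- (\<beta> * ((?d - 1) / 2)))))"
        unfolding T_def using C(1) by (intro mult_left_mono) auto
      also have "\<dots> = D' * (1 / \<bar>det L\<bar> * (r powr ((?d + 1) / 2) * r powr (- (\<beta> * ((?d - 1) / 2)))) *
          (R powr ((?d - 1) / 2) * R powr (\<beta> * ((?d - 1) / 2))))"
        using R by (simp add: D'_def powr_mult)
      also have "r powr ((?d + 1) / 2) * r powr (- (\<beta> * ((?d - 1) / 2))) = r powr (2 * ?d / (?d + 1))"
      proof -
        have "(?d + 1) / 2 + - (\<beta> * ((?d - 1) / 2)) = 2 * ?d / (?d + 1)"
          using d1 by (simp add: \<beta>_def field_simps)
        then show ?thesis
          by (simp flip: powr_add)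
      qed
      also have "R powr ((?d - 1) / 2) * R powr (\<beta> * ((?d - 1) / 2)) = R powr (?d * \<beta>)"
      proof -
        have "(?d - 1) / 2 + \<beta> * ((?d - 1) / 2) = ?d * \<beta>"
          using d1 by (simp add: \<beta>_def field_simps)
        then show ?thesis
          by (simp flip: powr_add)
      qed
      finally have T: "T \<le> D' * (1 / \<bar>det L\<bar> * r powr (2 * ?d / (?d + 1)) * R powr (?d * \<beta>))" .
      have "W + T \<le> (D + D') * (1 / \<bar>det L\<bar> * r powr (2 * ?d / (?d + 1)) * R powr (?d * \<beta>))"
        unfolding W distrib_right[of D] using T by (rule add_left_mono)
      then show ?thesis
        by (simp only: mult.assoc mult_le_cancel_left_pos zero_less_numeral)
    qed
    finally show "\<bar>real (shifted_count L R 0) - unit_ball_vol ?d * R ^ CARD('n) / \<bar>det L\<bar>\<bar> \<le>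
        2 * (D + D') * (1 / \<bar>det L\<bar> * r powr (2 * ?d / (?d + 1)) * R powr (?d * ((?d - 1) / (?d + 1))))"
      by (simp add: V_def v_def \<beta>_def)
  qed
qed

section \<open>Bases of a lattice\<close>

lemma lattice_of_matrix_conv_range: "lattice_of_matrix L = range (\<lambda>m. L *v int_vec m)"
proof (intro equalityI subsetI)
  fix v assume "v \<in> lattice_of_matrix L"
  then obtain x where x: "v = L *v x" "\<And>i. x $ i \<in> \<int>"
    unfolding lattice_of_matrix_def by blast
  then have "\<forall>i. \<exists>k. x $ i = of_int k"
    by (meson Ints_cases)
  then obtain m where "\<forall>i. x $ i = of_int (m i)"
    by metis
  then have "x = int_vec m"
    by (simp add: vec_eq_iff)
  with x(1) show "v \<in> range (\<lambda>m. L *v int_vec m)"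
    by blast
qed (auto simp: lattice_of_matrix_def)

lemma lattice_count_matrix:
  fixes L :: "real ^ 'n ^ 'n"
  assumes "invertible L"
  shows "lattice_count (lattice_of_matrix L) R = shifted_count L R 0"
proof -
  have "inj ((*v) L)"
    using assms by (metis inj_matrix_vector_mult)
  moreover have "inj (int_vec :: ('n \<Rightarrow> int) \<Rightarrow> real ^ 'n)"
    by (auto simp: inj_def vec_eq_iff fun_eq_iff)
  ultimately have inj: "inj (\<lambda>m. L *v int_vec m)"
    using inj_compose by (auto simp: o_def)
  have "{v \<in> lattice_of_matrix L. norm v < R} = (\<lambda>m. L *v int_vec m) ` {m. norm (L *v (0 + int_vec m)) < R}"
    by (auto simp: lattice_of_matrix_conv_range)
  then show ?thesis
    unfolding lattice_count_def shifted_count_def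
    by (simp add: card_image inj_on_subset[OF inj])
qed

text \<open>Independence over the integers is independence over the rationals, and there the columns of
  any matrix for the lattice form a spanning set.\<close>
lemma card_Z_basis:
  fixes L :: "real ^ 'n ^ 'n"
  assumes L: "invertible L" and B: "Z_basis B (lattice_of_matrix L)" and r: "B \<subseteq> ball 0 r"
  shows "finite B" "card B = CARD('n)"
proof -
  let ?\<Lambda> = "lattice_of_matrix L"
  interpret rat: vector_space "\<lambda>(q::rat) (v :: real ^ 'n). of_rat q *\<^sub>R v"
    by unfold_locales (simp_all add: of_rat_add of_rat_mult algebra_simps)
  have span: "int_module.span B = ?\<Lambda>" and ind: "int_module.independent B"
    using B by (auto simp: Z_basis_def)
  then have sub: "B \<subseteq> ?\<Lambda>"
    using int_module.span_superset by blast
  have rep: "\<exists>m. v = L *v int_vec m" if "v \<in> ?\<Lambda>" for v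
    using that by (auto simp: lattice_of_matrix_conv_range)
  have "B \<subseteq> (\<lambda>m. L *v int_vec m) ` {m. norm (L *v (0 + int_vec m)) < r}"
  proof
    fix v assume v: "v \<in> B"
    then obtain m where "v = L *v int_vec m"
      using rep sub by blast
    with v r show "v \<in> (\<lambda>m. L *v int_vec m) ` {m. norm (L *v (0 + int_vec m)) < r}"
      by auto
  qed
  then show fin: "finite B"
    using shifted_count_bounded(1)[OF L] finite_subset by blast
  have "rat.independent B"
    unfolding rat.dependent_finite[OF fin]
  proof (safe, goal_cases)
    case (1 u v)
    \<comment> \<open>A common denominator, which turns a rational relation into an integral
      one.\<close>
    define D where "D = (\<Prod>v\<in>B. snd (quotient_of (u v)))"
    have D: "D \<noteq> 0"
      using fin quotient_of_denom_pos' by (auto simp: D_def prod_zero_iff less_imp_neq[symmetric])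
    have "\<exists>c. of_int D * u w = of_int c" if "w \<in> B" for w
    proof -
      obtain a b where ab: "quotient_of (u w) = (a, b)"
        by (cases "quotient_of (u w)")
      have "snd (quotient_of (u w)) dvd D"
        unfolding D_def using fin that by (rule dvd_prodI)
      then obtain e where e: "D = b * e"
        unfolding ab by auto
      have "u w = of_int a / of_int b" "b > 0"
        using quotient_of_div[OF ab] quotient_of_denom_pos[OF ab] by auto
      then have "of_int D * u w = of_int (a * e)"
        by (simp add: e)
      then show ?thesis
        by blast
    qed
    then obtain c where c: "\<And>w. w \<in> B \<Longrightarrow> of_int D * u w = of_int (c w)"
      by metis
    have "(\<Sum>w\<in>B. of_int (c w) *\<^sub>R w) = of_int D *\<^sub>R (\<Sum>w\<in>B. of_rat (u w) *\<^sub>R w)"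
      unfolding scaleR_sum_right
    proof (intro sum.cong refl)
      fix w assume "w \<in> B"
      then have "real_of_rat (of_int (c w)) = real_of_rat (of_int D * u w)"
        using c by simp
      then show "of_int (c w) *\<^sub>R w = of_int D *\<^sub>R of_rat (u w) *\<^sub>R w"
        by (simp add: of_rat_mult)
    qed
    also have "\<dots> = 0"
      using 1 by simp
    finally have "c v = 0"
      using ind 1 unfolding int_module.dependent_finite[OF fin] by blast
    moreover have "of_int D * u v = of_int (c v)"
      using 1 by (intro c)
    ultimately show ?case
      using D 1 by simp
  qed
  moreover have "B \<subseteq> rat.span (range (\<lambda>j. column j L))"
  proof
    fix v assume "v \<in> B"
    then obtain m where "v = L *v int_vec m"
      using rep sub by blast
    then have "v = (\<Sum>j\<in>UNIV. of_rat (of_int (m j)) *\<^sub>R column j L)"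
      by (simp add: matrix_vector_mult_columns_scaleR)
    also have "\<dots> \<in> rat.span (range (\<lambda>j. column j L))"
      by (intro rat.span_sum rat.span_scale rat.span_base) auto
    finally show "v \<in> rat.span (range (\<lambda>j. column j L))" .
  qed
  ultimately have "card B \<le> card (range (\<lambda>j. column j L))"
    using rat.independent_span_bound[of "range (\<lambda>j. column j L)" B] by simp
  also have "\<dots> \<le> CARD('n)"
    by (rule card_image_le) simp
  finally have upper: "card B \<le> CARD('n)" .
  \<comment> \<open>The lower bound on the cardinality is over the reals: a set generating the
    lattice over the integers spans the whole space.\<close>
  have "span ?\<Lambda> = UNIV"
    using L full_lattice_iff_matrix[of ?\<Lambda>] by (auto simp: full_lattice_def)
  moreover have "?\<Lambda> \<subseteq> span B"
    unfolding span[symmetric]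
  proof (rule int_module.span_minimal)
    show "int_module.subspace (span B)"
      by (auto simp: int_module.subspace_def span_add span_scale span_zero)
  qed (rule span_superset)
  ultimately have "span B = UNIV"
    using span_minimal[of ?\<Lambda> "span B"] by auto
  then have "CARD('n) \<le> card B"
    using dim_le_card[of UNIV B] fin by (simp add: dim_UNIV)
  with upper show "card B = CARD('n)"
    by simp
qed

text \<open>\<open>r_bas\<close> ranges over arbitrary \<open>Z_basis\<close> sets, with no
  cardinality in the definition; knowing that each has \<open>CARD('n)\<close> elements allows its
  vectors to be listed as the columns of a square matrix.\<close>

lemma lattice_matrix_of_Z_basis:
  fixes \<Lambda> :: "(real ^ 'n) set"
  assumes \<Lambda>: "full_lattice \<Lambda>" and B: "Z_basis B \<Lambda>" "B \<subseteq> ball 0 r"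
  obtains L where "invertible L" "\<Lambda> = lattice_of_matrix L" "\<And>i. norm (column i L) < r"
proof -
  obtain L0 where L0: "invertible L0" "\<Lambda> = lattice_of_matrix L0"
    using \<Lambda> full_lattice_iff_matrix by blast
  have fin: "finite B" and card: "card B = CARD('n)"
    using card_Z_basis[OF L0(1) _ B(2)] B(1) L0(2) by auto
  obtain f :: "'n \<Rightarrow> real ^ 'n" where f: "bij_betw f UNIV B"
    using fin card finite_same_card_bij[of "UNIV :: 'n set" B] by auto
  define L :: "real ^ 'n ^ 'n" where "L = (\<chi> i j. f j $ i)"
  have col: "column j L = f j" for j
    by (simp add: L_def column_def vec_eq_iff)
  have rng: "range (\<lambda>j. column j L) = B" and inj: "inj (\<lambda>j. column j L)"
    using f by (simp_all add: col[abs_def] bij_betw_def)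
  have eq: "\<Lambda> = lattice_of_matrix L"
    using lattice_of_matrix_eq_int_span[OF inj] rng B(1) by (simp add: Z_basis_def)
  have "\<Lambda> \<subseteq> range ((*v) L)"
    unfolding eq lattice_of_matrix_def by auto
  moreover have "subspace (range ((*v) L))"
    by (intro linear_subspace_image) auto
  ultimately have "span \<Lambda> \<subseteq> range ((*v) L)"
    by (rule span_minimal)
  then have "surj ((*v) L)"
    using \<Lambda> by (auto simp: full_lattice_def)
  then have "invertible L"
    by (metis invertible_right_inverse matrix_right_invertible_surjective)
  moreover have "norm (column i L) < r" for i
  proof -
    have "column i L \<in> ball 0 r"
      using rng B(2) by blast
    then show ?thesis by simp
  qed
  ultimately show thesis
    using that eq by blast
qed

theorem theorem1:
  "\<exists>C::real. \<forall>(\<Lambda> :: (real ^ 'n) set) (R::real).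
     full_lattice \<Lambda> \<and> R > 0 \<and> R > r_bas \<Lambda> \<longrightarrow>
       \<bar>real (lattice_count \<Lambda> R)
          - pi powr (real CARD('n) / 2) / Gamma (real CARD('n) / 2 + 1)
              * (R ^ CARD('n) / \<bar>lattice_det \<Lambda>\<bar>)\<bar>
       \<le> C * (1 / \<bar>lattice_det \<Lambda>\<bar>
              * r_bas \<Lambda> powr (2 * real CARD('n) / (real CARD('n) + 1))
              * R powr (real CARD('n) * ((real CARD('n) - 1) / (real CARD('n) + 1))))"
proof -
  let ?d = "real CARD('n)"
  obtain C where C: "C \<ge> 0" "\<And>(L :: real ^ 'n ^ 'n) r R.
     invertible L \<Longrightarrow> (\<And>i. norm (column i L) \<le> r) \<Longrightarrow> 0 < r \<Longrightarrow> r < R \<Longrightarrow>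
     \<bar>real (shifted_count L R 0) - unit_ball_vol ?d * R ^ CARD('n) / \<bar>det L\<bar>\<bar> \<le>
       C * (1 / \<bar>det L\<bar> * r powr (2 * ?d / (?d + 1)) * R powr (?d * ((?d - 1) / (?d + 1))))"
    using matrix_lattice_count_error[where 'n = 'n] by blast
  show ?thesis
  proof (intro exI[of _ C] allI impI, elim conjE)
    fix \<Lambda> :: "(real ^ 'n) set" and R :: real
    assume \<Lambda>: "full_lattice \<Lambda>" and R: "R > 0" "R > r_bas \<Lambda>"
    define S where "S = {r. r > 0 \<and> (\<exists>B. Z_basis B \<Lambda> \<and> B \<subseteq> ball 0 r)}"
    have ne: "S \<noteq> {}"
    proof -
      obtain B where B: "Z_basis B \<Lambda>" "finite B"
        using \<Lambda> by (auto simp: full_lattice_def)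
      then obtain r where "r > 0" "B \<subseteq> ball 0 r"
        using bounded_subset_ballD[OF finite_imp_bounded, of B 0] by blast
      with B show ?thesis
        by (auto simp: S_def)
    qed
    have bdd: "bdd_below S"
      by (auto simp: S_def intro!: bdd_belowI[of _ 0] less_imp_le)
    have r_bas: "r_bas \<Lambda> = Inf S"
      by (simp add: r_bas_def S_def)
    have nonneg: "0 \<le> r_bas \<Lambda>"
      unfolding r_bas by (rule cInf_greatest[OF ne]) (simp add: S_def)
    let ?err = "\<bar>real (lattice_count \<Lambda> R) - unit_ball_vol ?d * R ^ CARD('n) / lattice_det \<Lambda>\<bar>"
    let ?bound = "\<lambda>r. C * (1 / lattice_det \<Lambda> * r powr (2 * ?d / (?d + 1)) * R powr (?d * ((?d - 1) / (?d + 1))))"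
    have det0: "0 \<le> lattice_det \<Lambda>"
    proof -
      obtain L where "invertible L" "\<Lambda> = lattice_of_matrix L"
        using \<Lambda> full_lattice_iff_matrix by blast
      then show ?thesis
        using lattice_det_eq[of L] by simp
    qed
    \<comment> \<open>A radius strictly above the infimum exceeds some member \<open>s\<close> of
      \<open>S\<close>, whose ball contains a basis. The constant \<open>C\<close> is common to all
      \<open>r\<close>, so the limit can be taken afterwards.\<close>
    have "?err \<le> ?bound r" if r: "r_bas \<Lambda> < r" "r < R" for r
    proof -
      obtain s where s: "s \<in> S" "s < r"
        using r(1) cInf_less_iff[OF ne bdd] by (auto simp: r_bas)
      then obtain B where "Z_basis B \<Lambda>" "B \<subseteq> ball 0 s"
        by (auto simp: S_def)
      then obtain L where L: "invertible L" "\<Lambda> = lattice_of_matrix L" "\<And>i. norm (column i L) < s"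
        using lattice_matrix_of_Z_basis[OF \<Lambda>] by metis
      have "norm (column i L) \<le> r" for i
        using L(3)[of i] s by linarith
      moreover have "0 < r"
        using nonneg r by linarith
      ultimately show ?thesis
        using C(2)[OF L(1), of r R] r(2) L(1,2) by (simp add: lattice_count_matrix lattice_det_eq)
    qed
    then have ev: "eventually (\<lambda>r. ?err \<le> ?bound r) (at_right (r_bas \<Lambda>))"
      using R(2) by (auto simp: eventually_at_right_field)
    have lim: "(?bound \<longlongrightarrow> ?bound (r_bas \<Lambda>)) (at_right (r_bas \<Lambda>))"
    proof -
      \<comment> \<open>Only \<open>0 \<le> r_bas \<Lambda>\<close> is at hand; since the exponent
        is positive, \<open>powr\<close> is continuous on the nonnegative half-line including
        0.\<close>
      have "continuous_on {r_bas \<Lambda>..} (\<lambda>r. r powr (2 * ?d / (?d + 1)))"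
        using nonneg by (intro continuous_on_powr' continuous_intros) auto
      then have "((\<lambda>r. r powr (2 * ?d / (?d + 1))) \<longlongrightarrow> r_bas \<Lambda> powr (2 * ?d / (?d + 1))) (at (r_bas \<Lambda>) within {r_bas \<Lambda>..})"
        by (simp add: continuous_on_def)
      then have "((\<lambda>r. r powr (2 * ?d / (?d + 1))) \<longlongrightarrow> r_bas \<Lambda> powr (2 * ?d / (?d + 1))) (at_right (r_bas \<Lambda>))"
        by (rule tendsto_within_subset) auto
      then show ?thesis
        by (intro tendsto_mult tendsto_const)
    qed
    have "?err \<le> ?bound (r_bas \<Lambda>)"
      by (rule tendsto_lowerbound[OF lim ev]) simp
    then show "\<bar>real (lattice_count \<Lambda> R) - pi powr (?d / 2) / Gamma (?d / 2 + 1) * (R ^ CARD('n) / \<bar>lattice_det \<Lambda>\<bar>)\<bar>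
       \<le> C * (1 / \<bar>lattice_det \<Lambda>\<bar> * r_bas \<Lambda> powr (2 * ?d / (?d + 1)) * R powr (?d * ((?d - 1) / (?d + 1))))"
      using det0 by (simp add: unit_ball_vol_def)
  qed
qed

end
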